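(* Let $\alpha$ be a confluent non-expansive partial action of a monoid $M$ on a metric space $(X,d)$ (with a fixed witnessing confluent presentation $\langle G\mid R\rangle$ of $M$), and let $(Y,D)$ be its free (weak pseudometric) globalization. If $\alpha$ is closed and nowhere degenerate, then $(Y,D)$ is a metric space and $\dim(Y)=\dim(X)$.
   Context: $\dim$ is (Lebesgue) covering dimension. Partial action: a partial map $M\times X\to X$, $(u,x)\mapsto u\cdot x$, with $e\cdot x=x$ for all $x$ ($e$ the unit of $M$) and such that, whenever $v\cdot x$ is defined, $(uv)\cdot x$ is defined iff $u\cdot(v\cdot x)$ is defined, in which case they are equal. $\operatorname{dom}(u)$ is the set of $x\in X$ with $u\cdot x$ defined. It is non-expansive if $d(u\cdot x,u\cdot y)\le d(x,y)$ for all $u\in M$, $x,y\in\operatorname{dom}(u)$, and closed if $\operatorname{dom}(u)$ is closed in $X$ for each $u\in M$. It is nowhere degenerate if $\operatorname{dom}(g)\ne\emptyset$ for each generator $g\in G$ of the fixed presentation. Globalization: $Y=(M\times X)/{\simeq}$, where $\simeq$ is the equivalence relation generated by $(uv,x)\sim(u,v\cdot x)$ whenever $v\cdot x$ is defined; $[u,x]$ is the class of $(u,x)$. $M$ acts on $Y$ by $u\cdot[v,x]=[uv,x]$. The distance $D(a,b)\in[0,\infty]$ on $Y$ is the infimum (with $\inf\emptyset=\infty$) of $\sum_{j=1}^n d(x_j,y_j)$ over all paths from $a$ to $b$, i.e. finite sequences $((u_j,x_j,y_j))_{j=1}^n$, $n\ge1$, $u_j\in M$, $x_j,y_j\in X$,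 with $[u_1,x_1]=a$, $[u_j,y_j]=[u_{j+1},x_{j+1}]$ for $1\le j<n$, and $[u_n,y_n]=b$. Confluence: A monoid presentation $\langle G\mid R\rangle$ consists of a set $G$ and a set $R\subset G^*\times G^*$ of directed reduction rules $l\to r$ ($G^*$ is the set of finite words over $G$). It induces a one-step reduction $w_1lw_2\to w_1rw_2$ on $G^*$; the presented monoid is $G^*$ modulo the equivalence relation generated by $\to$. A word is normal if no one-step reduction applies to it; a normal form of $w$ is a normal word equivalent to $w$. The presentation is confluent if there is no infinite sequence of one-step reductions, every word has a unique normal form, and no rule has a left side consisting of a single letter. Given a presentation of $M$, one-step reduction on $G^*\times X$ is defined by $(g_n\dots g_1,x)\to(g_n\dots g_2,g_1\cdot x)$ whenever $g_1\cdot x$ is defined, and $(w_1,x)\to(w_2,x)$ whenever $w_1\to w_2$ in $G^*$; normality and normal forms are defined as before. The partial action is confluent if $M$ has a confluent presentation $\langle G\mid R\rangle$ such that every element of $G^*\times X$ has a unique normal form and, whenever $(g_n\dots g_1)\cdot x=y$ holds in $X$ (with $g_i\in G$), $(g_n\dots g_1,x)$ can be transformed into $((),y)$ by finitely many one-step reductions, where $()$ is the empty word. *)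

theory Defs
  imports "HOL-Analysis.Analysis"
begin

section \<open>Covering dimension\<close>

text \<open>Definition by finite open covers, as in Engelking's \<^emph>\<open>Dimension Theory\<close> (on metrizable
  spaces it agrees with the one by arbitrary open covers). A space has dimension at most \<open>n\<close> if
  every finite open cover has a finite open refinement that covers and has every point in at most
  \<open>n + 1\<close> members. The empty space gets dimension \<open>-1\<close>, and a space that
  satisfies no such bound gets \<open>\<infinity>\<close>.\<close>

definition open_cover :: "'a topology \<Rightarrow> 'a set set \<Rightarrow> bool" where
  "open_cover T \<U> \<longleftrightarrow> (\<forall>U\<in>\<U>. openin T U) \<and> \<Union>\<U> = topspace T"

definition covering_dim_le :: "'a topology \<Rightarrow> int \<Rightarrow> bool" where
  "covering_dim_le T n \<longleftrightarrow>
     (\<forall>\<U>. finite \<U> \<and> open_cover T \<U> \<longrightarrow>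
        (\<exists>\<V>. finite \<V> \<and> open_cover T \<V> \<and> (\<forall>V\<in>\<V>. \<exists>U\<in>\<U>. V \<subseteq> U) \<and>
             (\<forall>x\<in>topspace T. int (card {V\<in>\<V>. x \<in> V}) \<le> n + 1)))"

definition covering_dim :: "'a topology \<Rightarrow> ereal" where
  "covering_dim T = (INF n\<in>{n::int. -1 \<le> n \<and> covering_dim_le T n}. ereal (real_of_int n))"


section \<open>Partial actions\<close>

text \<open>The space is a carrier set \<open>X\<close>, so it may be empty. A partial map from \<open>M \<times> X\<close> to \<open>X\<close> is
  an option-valued function that is \<^const>\<open>None\<close> outside \<open>X\<close>. In the last clause, equality of
  options says that both sides are undefined, or both are defined and equal.\<close>

definition partial_action :: "'x set \<Rightarrow> ('m::monoid_mult \<Rightarrow> 'x \<Rightarrow> 'x option) \<Rightarrow> bool" where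
  "partial_action X \<alpha> \<longleftrightarrow>
     (\<forall>u x y. \<alpha> u x = Some y \<longrightarrow> x \<in> X \<and> y \<in> X) \<and>
     (\<forall>x\<in>X. \<alpha> 1 x = Some x) \<and>
     (\<forall>u v x y. \<alpha> v x = Some y \<longrightarrow> \<alpha> (u * v) x = \<alpha> u y)"

definition pdom :: "('m \<Rightarrow> 'x \<Rightarrow> 'x option) \<Rightarrow> 'm \<Rightarrow> 'x set" where
  "pdom \<alpha> u = {x. \<alpha> u x \<noteq> None}"

definition non_expansive :: "('x \<Rightarrow> 'x \<Rightarrow> real) \<Rightarrow> ('m \<Rightarrow> 'x \<Rightarrow> 'x option) \<Rightarrow> bool" where
  "non_expansive d \<alpha> \<longleftrightarrow>
     (\<forall>u. \<forall>x\<in>pdom \<alpha> u. \<forall>y\<in>pdom \<alpha> u. d (the (\<alpha> u x)) (the (\<alpha> u y)) \<le> d x y)"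

definition closed_action ::
  "'x set \<Rightarrow> ('x \<Rightarrow> 'x \<Rightarrow> real) \<Rightarrow> ('m \<Rightarrow> 'x \<Rightarrow> 'x option) \<Rightarrow> bool" where
  "closed_action X d \<alpha> \<longleftrightarrow> (\<forall>u. closedin (Metric_space.mtopology X d) (pdom \<alpha> u))"


section \<open>Monoid presentations\<close>

text \<open>The word \<open>g\<^sub>n \<dots> g\<^sub>1\<close> is the list \<open>[g\<^sub>n, \<dots>, g\<^sub>1]\<close>.\<close>

inductive word_step :: "'g set \<Rightarrow> ('g list \<times> 'g list) set \<Rightarrow> 'g list \<Rightarrow> 'g list \<Rightarrow> bool"
  for G R where
  "\<lbrakk>(l, r) \<in> R; w1 \<in> lists G; w2 \<in> lists G\<rbrakk> \<Longrightarrow> word_step G R (w1 @ l @ w2) (w1 @ r @ w2)"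

definition normal_form_in :: "'a set \<Rightarrow> ('a \<Rightarrow> 'a \<Rightarrow> bool) \<Rightarrow> 'a \<Rightarrow> 'a \<Rightarrow> bool" where
  "normal_form_in A step a b \<longleftrightarrow> b \<in> A \<and> equivclp step a b \<and> (\<nexists>c. step b c)"

text \<open>The map \<open>\<iota>\<close> sends each generator to the element of the monoid that it denotes, and \<open>eval_word\<close>
  is its extension to words. The monoid is presented by \<open>G\<close> and \<open>R\<close> via \<open>\<iota>\<close> if this
  extension induces an isomorphism from \<open>G\<^sup>*\<close> modulo the equivalence generated by reduction.\<close>

definition eval_word :: "('g \<Rightarrow> 'm::monoid_mult) \<Rightarrow> 'g list \<Rightarrow> 'm" where
  "eval_word \<iota> w = prod_list (map \<iota> w)"

definition presents ::
  "'g set \<Rightarrow> ('g list \<times> 'g list) set \<Rightarrow> ('g \<Rightarrow> 'm::monoid_mult) \<Rightarrow> bool" where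
  "presents G R \<iota> \<longleftrightarrow>
     R \<subseteq> lists G \<times> lists G \<and>
     eval_word \<iota> ` lists G = UNIV \<and>
     (\<forall>v\<in>lists G. \<forall>w\<in>lists G. eval_word \<iota> v = eval_word \<iota> w \<longleftrightarrow> equivclp (word_step G R) v w)"

definition confluent_presentation :: "'g set \<Rightarrow> ('g list \<times> 'g list) set \<Rightarrow> bool" where
  "confluent_presentation G R \<longleftrightarrow>
     (\<nexists>f :: nat \<Rightarrow> 'g list. \<forall>i. word_step G R (f i) (f (Suc i))) \<and>
     (\<forall>w\<in>lists G. \<exists>!v. normal_form_in (lists G) (word_step G R) w v) \<and>
     (\<forall>(l, r)\<in>R. length l \<noteq> 1)"


section \<open>Confluent partial actions\<close>

inductive pair_step ::
  "'g set \<Rightarrow> ('g list \<times> 'g list) set \<Rightarrow> ('g \<Rightarrow> 'm) \<Rightarrow> 'x set \<Rightarrow> ('m \<Rightarrow> 'x \<Rightarrow> 'x option) \<Rightarrow>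
   'g list \<times> 'x \<Rightarrow> 'g list \<times> 'x \<Rightarrow> bool"
  for G R \<iota> X \<alpha> where
  act: "\<lbrakk>w \<in> lists G; g \<in> G; x \<in> X; \<alpha> (\<iota> g) x = Some y\<rbrakk> \<Longrightarrow> pair_step G R \<iota> X \<alpha> (w @ [g], x) (w, y)"
| rewrite: "\<lbrakk>word_step G R w1 w2; x \<in> X\<rbrakk> \<Longrightarrow> pair_step G R \<iota> X \<alpha> (w1, x) (w2, x)"

text \<open>Confluence of \<open>\<alpha>\<close>, witnessed by the presentation \<open>\<langle>G | R\<rangle>\<close> of the monoid via \<open>\<iota>\<close>.\<close>

definition confluent_action ::
  "'g set \<Rightarrow> ('g list \<times> 'g list) set \<Rightarrow> ('g \<Rightarrow> 'm::monoid_mult) \<Rightarrow> 'x set \<Rightarrow>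
   ('m \<Rightarrow> 'x \<Rightarrow> 'x option) \<Rightarrow> bool" where
  "confluent_action G R \<iota> X \<alpha> \<longleftrightarrow>
     presents G R \<iota> \<and> confluent_presentation G R \<and>
     (\<forall>p\<in>lists G \<times> X. \<exists>!q. normal_form_in (lists G \<times> X) (pair_step G R \<iota> X \<alpha>) p q) \<and>
     (\<forall>w\<in>lists G. \<forall>x\<in>X. \<forall>y\<in>X. \<alpha> (eval_word \<iota> w) x = Some y \<longrightarrow>
        (pair_step G R \<iota> X \<alpha>)\<^sup>*\<^sup>* (w, x) ([], y))"

definition nowhere_degenerate :: "'g set \<Rightarrow> ('g \<Rightarrow> 'm) \<Rightarrow> ('m \<Rightarrow> 'x \<Rightarrow> 'x option) \<Rightarrow> bool" where
  "nowhere_degenerate G \<iota> \<alpha> \<longleftrightarrow> (\<forall>g\<in>G. pdom \<alpha> (\<iota> g) \<noteq> {})"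


section \<open>The globalization\<close>

inductive glob_step ::
  "('m::monoid_mult \<Rightarrow> 'x \<Rightarrow> 'x option) \<Rightarrow> 'm \<times> 'x \<Rightarrow> 'm \<times> 'x \<Rightarrow> bool"
  for \<alpha> where
  "\<alpha> v x = Some y \<Longrightarrow> glob_step \<alpha> (u * v, x) (u, y)"

definition glob_rel ::
  "'x set \<Rightarrow> ('m::monoid_mult \<Rightarrow> 'x \<Rightarrow> 'x option) \<Rightarrow> (('m \<times> 'x) \<times> ('m \<times> 'x)) set" where
  "glob_rel X \<alpha> = {(p, q). p \<in> UNIV \<times> X \<and> q \<in> UNIV \<times> X \<and> equivclp (glob_step \<alpha>) p q}"

definition glob ::
  "'x set \<Rightarrow> ('m::monoid_mult \<Rightarrow> 'x \<Rightarrow> 'x option) \<Rightarrow> ('m \<times> 'x) set set" where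
  "glob X \<alpha> = (UNIV \<times> X) // glob_rel X \<alpha>"

definition glob_class ::
  "'x set \<Rightarrow> ('m::monoid_mult \<Rightarrow> 'x \<Rightarrow> 'x option) \<Rightarrow> 'm \<Rightarrow> 'x \<Rightarrow> ('m \<times> 'x) set" where
  "glob_class X \<alpha> u x = glob_rel X \<alpha> `` {(u, x)}"

definition glob_path ::
  "'x set \<Rightarrow> ('m::monoid_mult \<Rightarrow> 'x \<Rightarrow> 'x option) \<Rightarrow> nat \<Rightarrow>
   (nat \<Rightarrow> 'm) \<Rightarrow> (nat \<Rightarrow> 'x) \<Rightarrow> (nat \<Rightarrow> 'x) \<Rightarrow> ('m \<times> 'x) set \<Rightarrow> ('m \<times> 'x) set \<Rightarrow> bool" where
  "glob_path X \<alpha> n u x y a b \<longleftrightarrow>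
     1 \<le> n \<and> (\<forall>j\<in>{1..n}. x j \<in> X \<and> y j \<in> X) \<and>
     glob_class X \<alpha> (u 1) (x 1) = a \<and>
     (\<forall>j\<in>{1..<n}. glob_class X \<alpha> (u j) (y j) = glob_class X \<alpha> (u (j + 1)) (x (j + 1))) \<and>
     glob_class X \<alpha> (u n) (y n) = b"

definition glob_dist ::
  "'x set \<Rightarrow> ('x \<Rightarrow> 'x \<Rightarrow> real) \<Rightarrow> ('m::monoid_mult \<Rightarrow> 'x \<Rightarrow> 'x option) \<Rightarrow>
   ('m \<times> 'x) set \<Rightarrow> ('m \<times> 'x) set \<Rightarrow> ennreal" where
  "glob_dist X d \<alpha> a b =
     Inf {ennreal (\<Sum>j=1..n. d (x j) (y j)) | n u x y. glob_path X \<alpha> n u x y a b}"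

end

theory Submission
  imports Defs
begin

text \<open>By confluence, every point of the globalization is \<open>[w, x]\<close> for a unique normal word \<open>w\<close> and
  a unique point \<open>x\<close> on which the last letter of \<open>w\<close> does not act. So \<open>Y\<close> is a tree of copies of
  \<open>X\<close> indexed by the normal words, where the copy of \<open>wg\<close> is glued to that of \<open>w\<close> along the closed
  set \<open>dom(g)\<close> by the non-expansive map \<open>g\<close>.

  Lower bounds for \<open>D\<close> come from 1-Lipschitz functions. Such a function on one copy that vanishes
  on its gluing set is extended by \<open>0\<close> to all copies that are not above it, and by McShane's formula
  to those above it, one letter at a time. For \<open>[w, x]\<close> in normal form with \<open>x\<close> at distance at
  least \<open>r\<close> from the gluing set, the function \<open>max(0, r - d(x, \<cdot>))\<close> shows that \<open>D\<close> is a metric and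
  that, within distance \<open>r\<close> of \<open>[w, x]\<close>, points of the same copy keep their distance while the other
  copies not above it stay away.

  Hence the points over words of length \<open>k\<close> at distance at least \<open>r\<close> from the gluing sets form a
  closed subset of \<open>Y\<close> that is a uniformly discrete union of closed pieces of \<open>X\<close>. Countably many of
  these sets cover \<open>Y\<close>, so \<open>dim Y \<le> dim X\<close> by the countable closed sum theorem; conversely \<open>X\<close>
  embeds into \<open>Y\<close> as a closed subspace.\<close>

section \<open>Covering dimension in normal spaces\<close>

text \<open>Members of a refinement that are assigned to the same \<open>U i\<close> are merged,
  which does not raise the order. In the form \<open>int N - 1\<close> for the dimension,
  \<open>N\<close> bounds the order, and \<open>N = 0\<close> stands for dimension -1.\<close>

lemma covering_dim_le_shrink:
  assumes dim: "covering_dim_le T (int N - 1)" and "finite I"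
    and op: "\<And>i. i \<in> I \<Longrightarrow> openin T (U i)" and cov: "topspace T \<subseteq> (\<Union>i\<in>I. U i)"
  obtains V where "\<And>i. i \<in> I \<Longrightarrow> openin T (V i)" "\<And>i. i \<in> I \<Longrightarrow> V i \<subseteq> U i"
    "topspace T \<subseteq> (\<Union>i\<in>I. V i)" "\<And>x. x \<in> topspace T \<Longrightarrow> card {i \<in> I. x \<in> V i} \<le> N"
proof -
  have "open_cover T (U ` I)"
    using op cov openin_subset unfolding open_cover_def by blast
  then obtain \<V> where \<V>: "finite \<V>" "open_cover T \<V>" "\<forall>V\<in>\<V>. \<exists>W\<in>U ` I. V \<subseteq> W"
    and ord: "\<forall>x\<in>topspace T. int (card {V\<in>\<V>. x \<in> V}) \<le> int N - 1 + 1"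
    using dim[unfolded covering_dim_le_def, rule_format, of "U ` I"] \<open>finite I\<close> by blast
  have "\<forall>V\<in>\<V>. \<exists>i. i \<in> I \<and> V \<subseteq> U i" using \<V>(3) by blast
  then obtain \<phi> where \<phi>: "\<And>V. V \<in> \<V> \<Longrightarrow> \<phi> V \<in> I \<and> V \<subseteq> U (\<phi> V)" by metis
  let ?V = "\<lambda>i. \<Union>{V\<in>\<V>. \<phi> V = i}"
  show ?thesis
  proof
    show "openin T (?V i)" if "i \<in> I" for i
      using \<V>(2) by (auto simp: open_cover_def)
    show "?V i \<subseteq> U i" if "i \<in> I" for i using \<phi> by blast
    show "topspace T \<subseteq> (\<Union>i\<in>I. ?V i)"
    proof
      fix x assume "x \<in> topspace T"
      then obtain V where "V \<in> \<V>" "x \<in> V" using \<V>(2) by (auto simp: open_cover_def)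
      then show "x \<in> (\<Union>i\<in>I. ?V i)" using \<phi> by blast
    qed
    show "card {i \<in> I. x \<in> ?V i} \<le> N" if "x \<in> topspace T" for x
    proof -
      have "{i \<in> I. x \<in> ?V i} \<subseteq> \<phi> ` {V\<in>\<V>. x \<in> V}" by auto
      then have "card {i \<in> I. x \<in> ?V i} \<le> card {V\<in>\<V>. x \<in> V}"
        using \<open>finite \<V>\<close> by (intro surj_card_le) auto
      also have "\<dots> \<le> N" using ord that by auto
      finally show ?thesis .
    qed
  qed
qed

text \<open>Passing from an indexed shrinking to its set of members can only identify members, so
  the order does not rise.\<close>

lemma covering_dim_leI:
  fixes T :: "'a topology"
  assumes "\<And>\<U>. \<lbrakk>finite \<U>; open_cover T \<U>\<rbrakk> \<Longrightarrow>
    \<exists>V :: 'a set \<Rightarrow> 'a set. (\<forall>U\<in>\<U>. openin T (V U) \<and> V U \<subseteq> U) \<and> topspace T \<subseteq> (\<Union>U\<in>\<U>. V U) \<and>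
      (\<forall>x\<in>topspace T. card {U\<in>\<U>. x \<in> V U} \<le> N)"
  shows "covering_dim_le T (int N - 1)"
  unfolding covering_dim_le_def
proof (intro allI impI)
  fix \<U> assume \<U>: "finite \<U> \<and> open_cover T \<U>"
  from assms[OF conjunct1[OF \<U>] conjunct2[OF \<U>]] obtain V :: "'a set \<Rightarrow> 'a set" where
    V: "\<forall>U\<in>\<U>. openin T (V U) \<and> V U \<subseteq> U"
      "topspace T \<subseteq> (\<Union>U\<in>\<U>. V U)" "\<forall>x\<in>topspace T. card {U\<in>\<U>. x \<in> V U} \<le> N"
    by (elim exE conjE)
  have "card {W \<in> V ` \<U>. x \<in> W} \<le> N" if "x \<in> topspace T" for x
  proof -
    have "card {W \<in> V ` \<U>. x \<in> W} \<le> card {U\<in>\<U>. x \<in> V U}"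
      using \<U> by (intro surj_card_le[where f = V]) auto
    also have "\<dots> \<le> N" using V(3) that by blast
    finally show ?thesis .
  qed
  moreover have "open_cover T (V ` \<U>)"
    unfolding open_cover_def
  proof (intro conjI equalityI)
    show "\<Union> (V ` \<U>) \<subseteq> topspace T" using V(1) openin_subset by blast
  qed (use V in auto)
  ultimately show "\<exists>\<V>. finite \<V> \<and> open_cover T \<V> \<and> (\<forall>V\<in>\<V>. \<exists>U\<in>\<U>. V \<subseteq> U) \<and>
             (\<forall>x\<in>topspace T. int (card {V\<in>\<V>. x \<in> V}) \<le> int N - 1 + 1)"
    using \<U> V(1) by (intro exI[of _ "V ` \<U>"]) auto
qed

text \<open>A cover is pushed forward along \<open>f\<close>, shrunk in \<open>T\<close> and pulled
  back. Closedness of \<open>f\<close> makes the pushed sets open; injectivity makes them cover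
  \<open>T\<close>.\<close>

lemma covering_dim_le_closed_map:
  assumes cont: "continuous_map S T f" and clo: "closed_map S T f"
    and inj: "inj_on f (topspace S)" and dim: "covering_dim_le T (int N - 1)"
  shows "covering_dim_le S (int N - 1)"
proof (rule covering_dim_leI)
  fix \<U> assume fin: "finite \<U>" and cov: "open_cover S \<U>"
  \<comment> \<open>The largest subset of \<open>topspace T\<close> whose preimage lies in
    \<open>U\<close>.\<close>
  let ?W = "\<lambda>U. topspace T - f ` (topspace S - U)"
  show "\<exists>V. (\<forall>U\<in>\<U>. openin S (V U) \<and> V U \<subseteq> U) \<and> topspace S \<subseteq> (\<Union>U\<in>\<U>. V U) \<and>
      (\<forall>x\<in>topspace S. card {U\<in>\<U>. x \<in> V U} \<le> N)"
  \<comment> \<open>An empty cover is treated apart: its empty family of sets \<open>?W U\<close>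
    cannot cover a nonempty \<open>T\<close>.\<close>
  proof (cases "\<U> = {}")
    case True
    then have "topspace S = {}" using cov by (simp add: open_cover_def)
    then show ?thesis using True by auto
  next
    case False
    have op: "openin T (?W U)" if "U \<in> \<U>" for U
    proof -
      have "closedin S (topspace S - U)" using cov that by (auto simp: open_cover_def)
      then show ?thesis using clo by (auto simp: closed_map_def)
    qed
    \<comment> \<open>A point outside every \<open>?W U\<close> has a preimage outside each
      \<open>U\<close>; by injectivity this is always the same point, which then no member of the
      cover contains.\<close>
    have "topspace T \<subseteq> (\<Union>U\<in>\<U>. ?W U)"
    proof (rule subsetI, rule ccontr)
      fix y assume y: "y \<in> topspace T" "y \<notin> (\<Union>U\<in>\<U>. ?W U)"
      then have *: "\<exists>x\<in>topspace S - U. f x = y" if "U \<in> \<U>" for U using that by blast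
      then obtain x where x: "x \<in> topspace S" "f x = y" using False by blast
      then obtain U where "U \<in> \<U>" "x \<in> U" using cov by (auto simp: open_cover_def)
      then show False using * x inj by (metis DiffD1 DiffD2 inj_onD)
    qed
    note W_cov = this
    obtain V where V: "\<And>U. U \<in> \<U> \<Longrightarrow> openin T (V U)" "\<And>U. U \<in> \<U> \<Longrightarrow> V U \<subseteq> ?W U"
      "topspace T \<subseteq> (\<Union>U\<in>\<U>. V U)" "\<And>x. x \<in> topspace T \<Longrightarrow> card {U \<in> \<U>. x \<in> V U} \<le> N"
      by (rule covering_dim_le_shrink[OF dim fin, of ?W]) (use op W_cov in blast)+
    have im: "f x \<in> topspace T" if "x \<in> topspace S" for x
      using cont that by (auto simp: continuous_map_def)
    show ?thesis
    proof (intro exI[of _ "\<lambda>U. {x \<in> topspace S. f x \<in> V U}"] conjI ballI)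
      show "openin S {x \<in> topspace S. f x \<in> V U}" if "U \<in> \<U>" for U
        using cont V(1)[OF that] by (auto simp: continuous_map_def)
      show "{x \<in> topspace S. f x \<in> V U} \<subseteq> U" if "U \<in> \<U>" for U
        using V(2)[OF that] by auto
      show "topspace S \<subseteq> (\<Union>U\<in>\<U>. {x \<in> topspace S. f x \<in> V U})"
        using V(3) im by auto
      show "card {U \<in> \<U>. x \<in> {x \<in> topspace S. f x \<in> V U}} \<le> N" if "x \<in> topspace S" for x
        using V(4)[OF im[OF that]] that by simp
    qed
  qed
qed

lemma covering_dim_le_closed_subtopology:
  assumes "closedin T C" "covering_dim_le T (int N - 1)"
  shows "covering_dim_le (subtopology T C) (int N - 1)"
proof (rule covering_dim_le_closed_map[OF _ _ _ assms(2)])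
  show "closed_map (subtopology T C) T (\<lambda>x. x)"
    using assms(1) by (auto simp: closed_map_def dest: closedin_trans_full)
qed auto

section \<open>The countable closed sum theorem\<close>

text \<open>The sets are replaced one at a time. The points missed by all the others form a closed
  subset of \<open>U k\<close>, around which normality gives an open set with closure in
  \<open>U k\<close>.\<close>

lemma finite_open_cover_shrink:
  assumes norm: "normal_space T" and "finite I"
    and op: "\<And>i. i \<in> I \<Longrightarrow> openin T (U i)" and cov: "topspace T \<subseteq> (\<Union>i\<in>I. U i)"
  obtains V where "\<And>i. i \<in> I \<Longrightarrow> openin T (V i)" "\<And>i. i \<in> I \<Longrightarrow> T closure_of (V i) \<subseteq> U i"
    "topspace T \<subseteq> (\<Union>i\<in>I. V i)"
proof -
  have "\<exists>V. (\<forall>i\<in>I. openin T (V i)) \<and> (\<forall>i\<in>P. T closure_of (V i) \<subseteq> U i) \<and>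
      (\<forall>i\<in>I - P. V i = U i) \<and> topspace T \<subseteq> (\<Union>i\<in>I. V i)" if "finite P" "P \<subseteq> I" for P
    using that
  proof (induction P rule: finite_induct)
    case empty
    then show ?case using op cov by (intro exI[of _ U]) auto
  next
    case (insert k P)
    then obtain V where V: "\<forall>i\<in>I. openin T (V i)" "\<forall>i\<in>P. T closure_of (V i) \<subseteq> U i"
      "\<forall>i\<in>I - P. V i = U i" "topspace T \<subseteq> (\<Union>i\<in>I. V i)" by auto
    define Z where "Z = topspace T - (\<Union>i\<in>I - {k}. V i)"
    have "closedin T Z"
      unfolding Z_def using V(1) by (intro closedin_diff closedin_topspace openin_Union) auto
    moreover have "openin T (U k)" using op insert.prems by blast
    moreover have "Z \<subseteq> U k"
    proof
      fix x assume x: "x \<in> Z"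
      then obtain i where i: "i \<in> I" "x \<in> V i" using V(4) unfolding Z_def by blast
      then have "x \<in> V k" using x by (cases "i = k") (auto simp: Z_def)
      then show "x \<in> U k" using V(3) insert.prems insert.hyps by auto
    qed
    ultimately obtain W where W: "openin T W" "Z \<subseteq> W" "T closure_of W \<subseteq> U k"
      using norm unfolding normal_space_alt by meson
    show ?case
    proof (intro exI[of _ "V(k := W)"] conjI)
      show "topspace T \<subseteq> (\<Union>i\<in>I. (V(k := W)) i)"
      proof
        fix x assume x: "x \<in> topspace T"
        show "x \<in> (\<Union>i\<in>I. (V(k := W)) i)"
        proof (cases "x \<in> Z")
          case True
          then have "x \<in> (V(k := W)) k" using W(2) by auto
          then show ?thesis using insert.prems by blast
        next
          case False
          then obtain i where "i \<in> I - {k}" "x \<in> V i" using x by (auto simp: Z_def)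
          then have "i \<in> I" "x \<in> (V(k := W)) i" by auto
          then show ?thesis by blast
        qed
      qed
      show "\<forall>i\<in>I. openin T ((V(k := W)) i)" using V(1) W(1) by simp
      show "\<forall>i\<in>insert k P. T closure_of ((V(k := W)) i) \<subseteq> U i" using V(2) W(3) by simp
      show "\<forall>i\<in>I - insert k P. (V(k := W)) i = U i" using V(3) by simp
    qed
  qed
  from this[OF \<open>finite I\<close> order.refl] obtain V where
    "\<forall>i\<in>I. openin T (V i)" "\<forall>i\<in>I. T closure_of (V i) \<subseteq> U i" "topspace T \<subseteq> (\<Union>i\<in>I. V i)"
    by blast
  then show ?thesis using that[of V] by blast
qed

text \<open>The sets are enlarged one at a time, each within the complement of the points that already
  lie in \<open>N\<close> of the others.\<close>

lemma finite_closed_family_swell: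
  assumes norm: "normal_space T" and "finite I"
    and cl: "\<And>i. i \<in> I \<Longrightarrow> closedin T (K i)" and op: "\<And>i. i \<in> I \<Longrightarrow> openin T (U i)"
    and KU: "\<And>i. i \<in> I \<Longrightarrow> K i \<subseteq> U i"
    and ord: "\<And>x. x \<in> topspace T \<Longrightarrow> card {i \<in> I. x \<in> K i} \<le> N"
  obtains V where "\<And>i. i \<in> I \<Longrightarrow> openin T (V i)" "\<And>i. i \<in> I \<Longrightarrow> K i \<subseteq> V i"
    "\<And>i. i \<in> I \<Longrightarrow> V i \<subseteq> U i" "\<And>x. x \<in> topspace T \<Longrightarrow> card {i \<in> I. x \<in> V i} \<le> N"
proof -
  \<comment> \<open>\<open>P\<close> collects the indices already treated. The order bound is kept
    for the closed sets \<open>L i\<close>, so that the points in \<open>N\<close> of them again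
    form a closed set at the next stage.\<close>
  have "\<exists>L. (\<forall>i\<in>I. closedin T (L i)) \<and> (\<forall>i\<in>P. \<exists>V. openin T V \<and> K i \<subseteq> V \<and> V \<subseteq> L i \<and> L i \<subseteq> U i) \<and>
      (\<forall>i\<in>I - P. L i = K i) \<and> (\<forall>x\<in>topspace T. card {i \<in> I. x \<in> L i} \<le> N)"
    if "finite P" "P \<subseteq> I" for P
    using that
  proof (induction P rule: finite_induct)
    case empty
    then show ?case using cl ord by (intro exI[of _ K]) auto
  next
    case (insert k P)
    then obtain L where L: "\<forall>i\<in>I. closedin T (L i)"
      "\<forall>i\<in>P. \<exists>V. openin T V \<and> K i \<subseteq> V \<and> V \<subseteq> L i \<and> L i \<subseteq> U i"
      "\<forall>i\<in>I - P. L i = K i" "\<forall>x\<in>topspace T. card {i \<in> I. x \<in> L i} \<le> N" by auto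
    have k: "k \<in> I" "k \<notin> P" using insert by auto
    \<comment> \<open>The points lying in at least \<open>N\<close> of the other sets. For
      \<open>N = 0\<close> the only \<open>J\<close> is empty, and the factor
      \<open>topspace T\<close> keeps the empty intersection inside the space.\<close>
    define Z where "Z = (\<Union>J\<in>{J. J \<subseteq> I - {k} \<and> card J = N}. topspace T \<inter> (\<Inter>j\<in>J. L j))"
    have Zc: "closedin T Z"
      unfolding Z_def
    proof (rule closedin_Union)
      show "finite ((\<lambda>J. topspace T \<inter> (\<Inter>j\<in>J. L j)) ` {J. J \<subseteq> I - {k} \<and> card J = N})"
        using \<open>finite I\<close> by simp
    next
      fix S assume "S \<in> (\<lambda>J. topspace T \<inter> (\<Inter>j\<in>J. L j)) ` {J. J \<subseteq> I - {k} \<and> card J = N}"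
      then obtain J where J: "J \<subseteq> I - {k}" and S: "S = topspace T \<inter> (\<Inter>j\<in>J. L j)" by auto
      show "closedin T S"
      proof (cases "J = {}")
        case False
        then have "closedin T (\<Inter>j\<in>J. L j)"
          using J L(1) by (intro closedin_Inter) auto
        then show ?thesis using S by auto
      qed (use S in auto)
    qed
    have ZK: "x \<notin> Z" if x: "x \<in> K k" for x
    proof
      assume "x \<in> Z"
      then obtain J where J: "J \<subseteq> I - {k}" "card J = N" "x \<in> topspace T" "\<forall>j\<in>J. x \<in> L j"
        by (auto simp: Z_def)
      have "insert k J \<subseteq> {i \<in> I. x \<in> L i}" using J L(3) k x by auto
      then have "card (insert k J) \<le> card {i \<in> I. x \<in> L i}"
        using \<open>finite I\<close> by (intro card_mono) auto
      moreover have "card (insert k J) = Suc N"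
        using J finite_subset[OF J(1)] \<open>finite I\<close> by (subst card_insert_disjoint) auto
      ultimately show False using L(4) J(3) by fastforce
    qed
    have "openin T (U k - Z)" "K k \<subseteq> U k - Z"
      using op Zc k KU ZK by auto
    then obtain W where W: "openin T W" "K k \<subseteq> W" "T closure_of W \<subseteq> U k - Z"
      using normal_space_alt[THEN iffD1, rule_format, OF norm, of "K k" "U k - Z"] cl[OF k(1)]
      by auto
    have WC: "W \<subseteq> T closure_of W" using W(1) by (simp add: closure_of_subset openin_subset)
    have "card {i \<in> I. x \<in> (L(k := T closure_of W)) i} \<le> N" if x: "x \<in> topspace T" for x
    proof (cases "x \<in> T closure_of W")
      case False
      then have "{i \<in> I. x \<in> (L(k := T closure_of W)) i} \<subseteq> {i \<in> I. x \<in> L i}" by auto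
      then have "card {i \<in> I. x \<in> (L(k := T closure_of W)) i} \<le> card {i \<in> I. x \<in> L i}"
        using \<open>finite I\<close> by (intro card_mono) auto
      then show ?thesis using L(4) x by fastforce
    next
      case True
      let ?J = "{i \<in> I - {k}. x \<in> L i}"
      have eq: "{i \<in> I. x \<in> (L(k := T closure_of W)) i} = insert k ?J"
        using True k by auto
      have "\<not> N \<le> card ?J"
      proof
        assume "N \<le> card ?J"
        then obtain J where "J \<subseteq> ?J" "card J = N" by (meson obtain_subset_with_card_n)
        then have "x \<in> Z" using x by (auto simp: Z_def)
        then show False using True W(3) by blast
      qed
      then show ?thesis unfolding eq using \<open>finite I\<close> by (subst card_insert_disjoint) auto
    qed
    moreover have "\<forall>i\<in>I. closedin T ((L(k := T closure_of W)) i)" using L(1) by auto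
    moreover have "\<forall>i\<in>insert k P. \<exists>V. openin T V \<and> K i \<subseteq> V \<and> V \<subseteq> (L(k := T closure_of W)) i \<and>
      (L(k := T closure_of W)) i \<subseteq> U i"
      using L(2) W WC k by auto
    moreover have "\<forall>i\<in>I - insert k P. (L(k := T closure_of W)) i = K i" using L(3) by auto
    ultimately show ?case by (intro exI[of _ "L(k := T closure_of W)"] conjI ballI) blast+
  qed
  from this[OF \<open>finite I\<close> order.refl] obtain L where
    L: "\<forall>i\<in>I. \<exists>V. openin T V \<and> K i \<subseteq> V \<and> V \<subseteq> L i \<and> L i \<subseteq> U i"
      "\<forall>x\<in>topspace T. card {i \<in> I. x \<in> L i} \<le> N" by blast
  from L(1) obtain V where V: "\<And>i. i \<in> I \<Longrightarrow> openin T (V i) \<and> K i \<subseteq> V i \<and> V i \<subseteq> L i \<and> L i \<subseteq> U i"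
    by metis
  have "card {i \<in> I. x \<in> V i} \<le> N" if "x \<in> topspace T" for x
  proof -
    have "card {i \<in> I. x \<in> V i} \<le> card {i \<in> I. x \<in> L i}"
      using V \<open>finite I\<close> by (intro card_mono) auto
    then show ?thesis using L(2) that by fastforce
  qed
  then show ?thesis using that[of V] V by blast
qed

text \<open>One stage of the sum theorem: the cover is refined inside \<open>F\<close>, left alone
  off \<open>F\<close>, and then shrunk so that the order bound on \<open>F\<close> passes to
  closures.\<close>

lemma open_cover_shrink_order_on_closed:
  assumes norm: "normal_space T" and F: "closedin T F"
    and dim: "covering_dim_le (subtopology T F) (int N - 1)" and "finite I"
    and op: "\<And>i. i \<in> I \<Longrightarrow> openin T (U i)" and cov: "topspace T \<subseteq> (\<Union>i\<in>I. U i)"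
  shows "\<exists>W. (\<forall>i\<in>I. openin T (W i)) \<and> topspace T \<subseteq> (\<Union>i\<in>I. W i) \<and>
    (\<forall>i\<in>I. T closure_of (W i) \<subseteq> U i) \<and> (\<forall>x\<in>F. card {i \<in> I. x \<in> T closure_of (W i)} \<le> N)"
proof -
  have FT: "F \<subseteq> topspace T" using F closedin_subset by blast
  obtain V where V: "\<And>i. i \<in> I \<Longrightarrow> openin (subtopology T F) (V i)" "\<And>i. i \<in> I \<Longrightarrow> V i \<subseteq> F \<inter> U i"
    "F \<subseteq> (\<Union>i\<in>I. V i)" "\<And>x. x \<in> F \<Longrightarrow> card {i \<in> I. x \<in> V i} \<le> N"
  proof (rule covering_dim_le_shrink[OF dim \<open>finite I\<close>, of "\<lambda>i. F \<inter> U i"])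
    show "topspace (subtopology T F) \<subseteq> (\<Union>i\<in>I. F \<inter> U i)" using cov by auto
  qed (use op FT in \<open>auto simp: openin_subtopology_Int2 inf.absorb2\<close>)
  \<comment> \<open>\<open>Q i\<close> is open because \<open>V i\<close> is the trace on
    \<open>F\<close> of an open set, which may be cut down to \<open>U i\<close>.\<close>
  define Q where "Q = (\<lambda>i. (U i - F) \<union> V i)"
  have Qop: "openin T (Q i)" if i: "i \<in> I" for i
  proof -
    obtain O' where O': "openin T O'" "V i = O' \<inter> F" using V(1)[OF i] by (auto simp: openin_subtopology)
    then have "Q i = (U i - F) \<union> (U i \<inter> O')" using V(2)[OF i] by (auto simp: Q_def)
    then show ?thesis using op[OF i] F O'(1) by (auto intro!: openin_Un openin_Int openin_diff)
  qed
  have Qcov: "topspace T \<subseteq> (\<Union>i\<in>I. Q i)"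
  proof
    fix x assume "x \<in> topspace T"
    then show "x \<in> (\<Union>i\<in>I. Q i)" using cov V(3) by (cases "x \<in> F") (auto simp: Q_def)
  qed
  obtain W where
    W: "\<And>i. i \<in> I \<Longrightarrow> openin T (W i)" "\<And>i. i \<in> I \<Longrightarrow> T closure_of (W i) \<subseteq> Q i"
    "topspace T \<subseteq> (\<Union>i\<in>I. W i)"
    by (rule finite_open_cover_shrink[OF norm \<open>finite I\<close>, of Q]) (use Qop Qcov in blast)+
  show ?thesis
  proof (intro exI[of _ W] conjI ballI W(1) W(3))
    show "T closure_of (W i) \<subseteq> U i" if "i \<in> I" for i
      using W(2)[OF that] V(2)[OF that] by (auto simp: Q_def)
    show "card {i \<in> I. x \<in> T closure_of (W i)} \<le> N" if "x \<in> F" for x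
    proof -
      have "{i \<in> I. x \<in> T closure_of (W i)} \<subseteq> {i \<in> I. x \<in> V i}"
        using W(2) that by (auto simp: Q_def)
      then have "card {i \<in> I. x \<in> T closure_of (W i)} \<le> card {i \<in> I. x \<in> V i}"
        using \<open>finite I\<close> by (intro card_mono) auto
      then show ?thesis using V(4)[OF that] by simp
    qed
  qed
qed

text \<open>Stage \<open>j\<close> shrinks the current cover until its closures have order at most
  \<open>N\<close> on \<open>F j\<close>. The intersections of the closures over all stages have
  order at most \<open>N\<close> everywhere, and are swollen to open sets inside the original
  cover.\<close>

lemma covering_dim_le_countable_closed_sum:
  fixes F :: "nat \<Rightarrow> 'a set"
  assumes norm: "normal_space T" and F: "\<And>j. closedin T (F j)"
    and dim: "\<And>j. covering_dim_le (subtopology T (F j)) (int N - 1)"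
    and un: "topspace T \<subseteq> (\<Union>j. F j)"
  shows "covering_dim_le T (int N - 1)"
proof (rule covering_dim_leI)
  fix \<U> assume fin: "finite \<U>" and cov: "open_cover T \<U>"
  define P where "P = (\<lambda>S::'a set \<Rightarrow> 'a set. (\<forall>U\<in>\<U>. openin T (S U)) \<and> topspace T \<subseteq> (\<Union>U\<in>\<U>. S U))"
  define Q where "Q = (\<lambda>j S S'. (\<forall>U\<in>\<U>. T closure_of (S' U) \<subseteq> S U) \<and>
    (\<forall>x\<in>F j. card {U\<in>\<U>. x \<in> T closure_of (S' U)} \<le> N))"
  \<comment> \<open>The clause for \<open>j = 0\<close> fixes the given cover as the start of the
    sequence.\<close>
  have "\<exists>S. \<forall>j. (P (S j) \<and> (j = 0 \<longrightarrow> S j = (\<lambda>U. U))) \<and> Q j (S j) (S (Suc j))"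
  proof (rule dependent_nat_choice[where P = "\<lambda>j S. P S \<and> (j = 0 \<longrightarrow> S = (\<lambda>U. U))" and Q = Q])
    show "\<exists>S. P S \<and> (0 = 0 \<longrightarrow> S = (\<lambda>U. U))"
      using cov by (auto simp: P_def open_cover_def)
    show "\<exists>S'. (P S' \<and> (Suc j = 0 \<longrightarrow> S' = (\<lambda>U. U))) \<and> Q j S S'" if PS: "P S \<and> (j = 0 \<longrightarrow> S = (\<lambda>U. U))" for S j
    proof -
      have "\<exists>W. (\<forall>i\<in>\<U>. openin T (W i)) \<and> topspace T \<subseteq> (\<Union>i\<in>\<U>. W i) \<and>
          (\<forall>i\<in>\<U>. T closure_of (W i) \<subseteq> S i) \<and> (\<forall>x\<in>F j. card {i \<in> \<U>. x \<in> T closure_of (W i)} \<le> N)"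
        by (rule open_cover_shrink_order_on_closed[OF norm F[of j] dim[of j] fin, of S])
          (use PS in \<open>simp_all add: P_def\<close>)
      then show ?thesis by (simp add: P_def Q_def conj_assoc)
    qed
  qed
  then obtain S where "\<forall>j. (P (S j) \<and> (j = 0 \<longrightarrow> S j = (\<lambda>U. U))) \<and> Q j (S j) (S (Suc j))"
    by (rule exE)
  then have S: "\<And>j. P (S j)" "S 0 = (\<lambda>U. U)" "\<And>j. Q j (S j) (S (Suc j))" by blast+
  have clS: "T closure_of (S (Suc j) U) \<subseteq> S j U" if "U \<in> \<U>" for j U
    using S(3) that by (auto simp: Q_def)
  have subcl: "S j U \<subseteq> T closure_of (S j U)" if "U \<in> \<U>" for j U
    using S(1) that by (auto simp: P_def intro!: closure_of_subset openin_subset)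
  have mono: "S (Suc j) U \<subseteq> S j U" if "U \<in> \<U>" for j U
    using clS[OF that] subcl[OF that] by blast
  have antimono: "S k U \<subseteq> S j U" if "j \<le> k" "U \<in> \<U>" for j k U
    using that(1) by (induction rule: dec_induct) (use mono[OF that(2)] in auto)
  \<comment> \<open>The \<open>K U\<close> still cover because the index set is finite and the \<open>S j U\<close> decrease in \<open>j\<close>.\<close>
  define K where "K = (\<lambda>U. \<Inter>j. T closure_of (S j U))"
  have Kcl: "closedin T (K U)" for U unfolding K_def by (intro closedin_Inter) auto
  have KU: "K U \<subseteq> U" if "U \<in> \<U>" for U
    using clS[OF that, of 0] S(2) by (auto simp: K_def)
  have Kcov: "topspace T \<subseteq> (\<Union>U\<in>\<U>. K U)"
  proof
    fix x assume x: "x \<in> topspace T"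
    have "\<forall>j. \<exists>U\<in>\<U>. x \<in> S j U" using S(1) x unfolding P_def by blast
    then obtain u where u: "\<And>j. u j \<in> \<U>" "\<And>j. x \<in> S j (u j)" by metis
    then have "finite (range u)" using fin by (meson finite_subset image_subsetI)
    then obtain k where k: "infinite {j. u j = u k}"
      using pigeonhole_infinite[of UNIV u] by auto
    have "x \<in> S j (u k)" for j
    proof -
      obtain i where "i \<ge> j" "u i = u k"
        using k by (metis (mono_tags, lifting) infinite_nat_iff_unbounded_le mem_Collect_eq)
      then show ?thesis using u antimono by (metis subsetD)
    qed
    then have "x \<in> K (u k)" using subcl u(1) by (auto simp: K_def)
    then show "x \<in> (\<Union>U\<in>\<U>. K U)" using u(1) by blast
  qed
  have Kord: "card {U\<in>\<U>. x \<in> K U} \<le> N" if x: "x \<in> topspace T" for x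
  proof -
    obtain j where j: "x \<in> F j" using un x by blast
    have "card {U\<in>\<U>. x \<in> K U} \<le> card {U\<in>\<U>. x \<in> T closure_of (S (Suc j) U)}"
      using fin by (intro card_mono) (auto simp: K_def)
    also have "\<dots> \<le> N" using S(3)[of j] j by (auto simp: Q_def)
    finally show ?thesis .
  qed
  have op: "openin T U" if "U \<in> \<U>" for U using cov that by (auto simp: open_cover_def)
  obtain V where V: "\<And>U. U \<in> \<U> \<Longrightarrow> openin T (V U)" "\<And>U. U \<in> \<U> \<Longrightarrow> K U \<subseteq> V U"
    "\<And>U. U \<in> \<U> \<Longrightarrow> V U \<subseteq> U" "\<And>x. x \<in> topspace T \<Longrightarrow> card {U \<in> \<U>. x \<in> V U} \<le> N"
    by (rule finite_closed_family_swell[OF norm fin, of K "\<lambda>U. U" N]) (use Kcl op KU Kord in auto)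
  have "topspace T \<subseteq> (\<Union>U\<in>\<U>. V U)" using Kcov V(2) by blast
  then show "\<exists>V. (\<forall>U\<in>\<U>. openin T (V U) \<and> V U \<subseteq> U) \<and> topspace T \<subseteq> (\<Union>U\<in>\<U>. V U) \<and>
      (\<forall>x\<in>topspace T. card {U\<in>\<U>. x \<in> V U} \<le> N)"
    using V by (intro exI[of _ V]) auto
qed

section \<open>The path pseudometric\<close>

text \<open>Both infima are approximated within \<open>e/2\<close>. This serves the triangle
  inequality, where \<open>S\<close> and \<open>T\<close> are the sets of lengths of the paths to be
  concatenated.\<close>

lemma ennreal_le_Inf_add:
  fixes z :: ennreal
  assumes "\<And>s t. \<lbrakk>s \<in> S; t \<in> T\<rbrakk> \<Longrightarrow> z \<le> s + t"
  shows "z \<le> Inf S + Inf T"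
proof (rule ennreal_le_epsilon)
  fix e :: real assume "Inf S + Inf T < top" "0 < e"
  moreover have "x < x + ennreal (e/2)" if "x < top" for x
    using that \<open>0 < e\<close> by (cases x) (simp_all add: ennreal_less_iff flip: ennreal_plus)
  moreover have "Inf S < top" "Inf T < top"
    using \<open>Inf S + Inf T < top\<close> by (simp_all add: less_top[symmetric])
  ultimately have "Inf S < Inf S + ennreal (e/2)" "Inf T < Inf T + ennreal (e/2)" by blast+
  then obtain s t where st: "s \<in> S" "s < Inf S + ennreal (e/2)" "t \<in> T" "t < Inf T + ennreal (e/2)"
    by (auto simp: Inf_less_iff)
  have "z \<le> s + t" using assms st by blast
  also have "\<dots> \<le> (Inf S + ennreal (e/2)) + (Inf T + ennreal (e/2))"
    using st by (intro add_mono) auto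
  also have "\<dots> = Inf S + Inf T + (ennreal (e/2) + ennreal (e/2))" by (simp add: ac_simps)
  also have "ennreal (e/2) + ennreal (e/2) = ennreal e"
    using \<open>0 < e\<close> by (simp flip: ennreal_plus)
  finally show "z \<le> Inf S + Inf T + ennreal e" .
qed

lemma glob_dist_le_path:
  assumes "glob_path X \<alpha> n u x y a b"
  shows "glob_dist X d \<alpha> a b \<le> ennreal (\<Sum>j=1..n. d (x j) (y j))"
  unfolding glob_dist_def using assms by (intro Inf_lower) blast

lemma glob_dist_greatest:
  assumes "\<And>n u x y. glob_path X \<alpha> n u x y a b \<Longrightarrow> z \<le> ennreal (\<Sum>j=1..n. d (x j) (y j))"
  shows "z \<le> glob_dist X d \<alpha> a b"
  unfolding glob_dist_def using assms by (intro Inf_greatest) blast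

text \<open>A path of length one stays in a single copy of \<open>X\<close>.\<close>

lemma glob_dist_same_sheet:
  assumes "x \<in> X" "y \<in> X"
  shows "glob_dist X d \<alpha> (glob_class X \<alpha> u x) (glob_class X \<alpha> u y) \<le> ennreal (d x y)"
proof -
  have "glob_path X \<alpha> 1 (\<lambda>_. u) (\<lambda>_. x) (\<lambda>_. y) (glob_class X \<alpha> u x) (glob_class X \<alpha> u y)"
    using assms by (simp add: glob_path_def)
  from glob_dist_le_path[OF this] show ?thesis by simp
qed

lemma glob_path_reverse:
  assumes "glob_path X \<alpha> n u x y a b"
  shows "glob_path X \<alpha> n (\<lambda>j. u (n + 1 - j)) (\<lambda>j. y (n + 1 - j)) (\<lambda>j. x (n + 1 - j)) b a"
proof -
  have *: "1 \<le> n" "\<And>j. j \<in> {1..n} \<Longrightarrow> x j \<in> X \<and> y j \<in> X" "glob_class X \<alpha> (u 1) (x 1) = a"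
    "\<And>j. j \<in> {1..<n} \<Longrightarrow> glob_class X \<alpha> (u j) (y j) = glob_class X \<alpha> (u (j + 1)) (x (j + 1))"
    "glob_class X \<alpha> (u n) (y n) = b"
    using assms by (auto simp: glob_path_def)
  have "glob_class X \<alpha> (u (n + 1 - j)) (x (n + 1 - j)) =
      glob_class X \<alpha> (u (n + 1 - (j + 1))) (y (n + 1 - (j + 1)))" if "j \<in> {1..<n}" for j
  proof -
    have "n - j \<in> {1..<n}" "n - j + 1 = n + 1 - j" using that by auto
    then show ?thesis using *(4)[of "n - j"] by simp
  qed
  moreover have "x (n + 1 - j) \<in> X \<and> y (n + 1 - j) \<in> X" if "j \<in> {1..n}" for j
    using that by (intro *(2)) auto
  ultimately show ?thesis
    using *(1,3,5) by (auto simp: glob_path_def)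
qed

lemma glob_dist_commute:
  assumes "\<And>x y. d x y = d y x"
  shows "glob_dist X d \<alpha> a b = glob_dist X d \<alpha> b a"
proof -
  have "glob_dist X d \<alpha> b a \<le> glob_dist X d \<alpha> a b" for a b
  proof (rule glob_dist_greatest)
    fix n u x y assume p: "glob_path X \<alpha> n u x y a b"
    have "(\<Sum>j=1..n. d (y (n + 1 - j)) (x (n + 1 - j))) = (\<Sum>j=1..n. d (x j) (y j))"
      by (subst sum.atLeastAtMost_rev) (auto intro!: sum.cong simp: assms)
    then show "glob_dist X d \<alpha> b a \<le> ennreal (\<Sum>j=1..n. d (x j) (y j))"
      using glob_dist_le_path[OF glob_path_reverse[OF p], of d] by simp
  qed
  from order.antisym[OF this this] show ?thesis .
qed

lemma glob_path_append:
  assumes p: "glob_path X \<alpha> n u x y a b" and q: "glob_path X \<alpha> m u' x' y' b c"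
  shows "glob_path X \<alpha> (n + m) (\<lambda>j. if j \<le> n then u j else u' (j - n))
    (\<lambda>j. if j \<le> n then x j else x' (j - n)) (\<lambda>j. if j \<le> n then y j else y' (j - n)) a c"
proof -
  let ?c = "glob_class X \<alpha>"
  have *: "1 \<le> n" "\<And>j. j \<in> {1..n} \<Longrightarrow> x j \<in> X \<and> y j \<in> X" "?c (u 1) (x 1) = a"
    "\<And>j. j \<in> {1..<n} \<Longrightarrow> ?c (u j) (y j) = ?c (u (j + 1)) (x (j + 1))"
    "?c (u n) (y n) = b"
    using p by (auto simp: glob_path_def)
  have **: "1 \<le> m" "\<And>j. j \<in> {1..m} \<Longrightarrow> x' j \<in> X \<and> y' j \<in> X" "?c (u' 1) (x' 1) = b"
    "\<And>j. j \<in> {1..<m} \<Longrightarrow> ?c (u' j) (y' j) = ?c (u' (j + 1)) (x' (j + 1))"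
    "?c (u' m) (y' m) = c"
    using q by (auto simp: glob_path_def)
  let ?u = "\<lambda>j. if j \<le> n then u j else u' (j - n)"
  let ?x = "\<lambda>j. if j \<le> n then x j else x' (j - n)"
  let ?y = "\<lambda>j. if j \<le> n then y j else y' (j - n)"
  have "?c (?u j) (?y j) = ?c (?u (j + 1)) (?x (j + 1))" if j: "j \<in> {1..<n + m}" for j
  proof -
    consider "j < n" | "j = n" | "j > n" by linarith
    then show ?thesis
    proof cases
      case 1
      then show ?thesis using *(4)[of j] j by simp
    next
      case 2
      then show ?thesis using *(5) **(3) by simp
    next
      case 3
      then have "j - n \<in> {1..<m}" "j + 1 - n = j - n + 1" using j by auto
      then show ?thesis using **(4)[of "j - n"] 3 by simp
    qed
  qed
  moreover have "?x j \<in> X \<and> ?y j \<in> X" if "j \<in> {1..n + m}" for j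
  proof (cases "j \<le> n")
    case False
    then have "j - n \<in> {1..m}" using that by auto
    then show ?thesis using **(2)[of "j - n"] False by simp
  qed (use *(2)[of j] that in auto)
  moreover have "?c (?u 1) (?x 1) = a" using *(1,3) by simp
  moreover have "?c (?u (n + m)) (?y (n + m)) = c" using **(1,5) by simp
  moreover have "1 \<le> n + m" using *(1) by simp
  ultimately show ?thesis by (simp add: glob_path_def)
qed

lemma glob_dist_triangle:
  assumes nn: "\<And>x y. 0 \<le> d x y"
  shows "glob_dist X d \<alpha> a c \<le> glob_dist X d \<alpha> a b + glob_dist X d \<alpha> b c"
  unfolding glob_dist_def[of X d \<alpha> a b] glob_dist_def[of X d \<alpha> b c]
proof (rule ennreal_le_Inf_add, clarify)
  fix n m u u' x x' y y'
  assume p: "glob_path X \<alpha> n u x y a b" and q: "glob_path X \<alpha> m u' x' y' b c"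
  let ?x = "\<lambda>j. if j \<le> n then x j else x' (j - n)"
  let ?y = "\<lambda>j. if j \<le> n then y j else y' (j - n)"
  have "(\<Sum>j=1..n+m. d (?x j) (?y j)) = (\<Sum>j=1..n. d (?x j) (?y j)) + (\<Sum>j=n+1..n+m. d (?x j) (?y j))"
    by (rule sum.ub_add_nat) simp
  also have "(\<Sum>j=1..n. d (?x j) (?y j)) = (\<Sum>j=1..n. d (x j) (y j))" by (rule sum.cong) auto
  also have "(\<Sum>j=n+1..n+m. d (?x j) (?y j)) = (\<Sum>j=1..m. d (x' j) (y' j))"
    using sum.shift_bounds_cl_nat_ivl[of "\<lambda>j. d (?x j) (?y j)" 1 n m] by (simp add: ac_simps)
  finally show "glob_dist X d \<alpha> a c \<le> ennreal (\<Sum>j=1..n. d (x j) (y j)) + ennreal (\<Sum>j=1..m. d (x' j) (y' j))"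
    using glob_dist_le_path[OF glob_path_append[OF p q], of d] nn by (simp add: sum_nonneg)
qed

section \<open>Normal forms\<close>

locale confluent_globalization = Metric_space X d
  for X :: "'x set" and d :: "'x \<Rightarrow> 'x \<Rightarrow> real" +
  fixes \<alpha> :: "'m::monoid_mult \<Rightarrow> 'x \<Rightarrow> 'x option"
    and G :: "'g set" and R :: "('g list \<times> 'g list) set" and \<iota> :: "'g \<Rightarrow> 'm"
  assumes action: "partial_action X \<alpha>"
    and nonexp: "non_expansive d \<alpha>"
    and confl: "confluent_action G R \<iota> X \<alpha>"
    and closed: "closed_action X d \<alpha>"
    and nondeg: "nowhere_degenerate G \<iota> \<alpha>"
begin

definition normal_words :: "'g list set" where
  "normal_words = {w \<in> lists G. \<nexists>v. word_step G R w v}"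

definition cls :: "'g list \<Rightarrow> 'x \<Rightarrow> ('m \<times> 'x) set" where
  "cls w x = glob_class X \<alpha> (eval_word \<iota> w) x"

text \<open>The last letter of the list acts first, so these are the pairs in
  \<open>lists G \<times> X\<close> to which no \<open>pair_step\<close> applies.\<close>

definition is_nf :: "'g list \<Rightarrow> 'x \<Rightarrow> bool" where
  "is_nf w x \<longleftrightarrow> w \<in> normal_words \<and> x \<in> X \<and> (w = [] \<or> \<alpha> (\<iota> (last w)) x = None)"

abbreviation "pstep \<equiv> pair_step G R \<iota> X \<alpha>"

lemma pres: "presents G R \<iota>" and cpres: "confluent_presentation G R"
  and nf_unique: "p \<in> lists G \<times> X \<Longrightarrow> \<exists>!q. normal_form_in (lists G \<times> X) pstep p q"
  and confl_reduces: "\<lbrakk>w \<in> lists G; x \<in> X; y \<in> X; \<alpha> (eval_word \<iota> w) x = Some y\<rbrakk> \<Longrightarrow> pstep\<^sup>*\<^sup>* (w, x) ([], y)"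
  using confl unfolding confluent_action_def by blast+

lemma action_in: "\<alpha> u x = Some y \<Longrightarrow> x \<in> X \<and> y \<in> X"
  using action by (auto simp: partial_action_def)

lemma action_nonexp: "\<lbrakk>\<alpha> u x = Some x'; \<alpha> u y = Some y'\<rbrakk> \<Longrightarrow> d x' y' \<le> d x y"
  using nonexp by (force simp: non_expansive_def pdom_def)

lemma eval_append: "eval_word \<iota> (v @ w) = eval_word \<iota> v * eval_word \<iota> w"
  by (simp add: eval_word_def)

text \<open>A word for \<open>m\<close> has a normal form, and equivalent words have the same
  value.\<close>

lemma normal_word_exists: "\<exists>w\<in>normal_words. eval_word \<iota> w = m"
proof -
  have "m \<in> eval_word \<iota> ` lists G" using pres by (simp add: presents_def)
  then obtain v where v: "v \<in> lists G" "eval_word \<iota> v = m" by blast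
  then obtain w where "normal_form_in (lists G) (word_step G R) v w"
    using cpres unfolding confluent_presentation_def by blast
  then have w: "w \<in> lists G" "equivclp (word_step G R) v w" "\<nexists>c. word_step G R w c"
    by (auto simp: normal_form_in_def)
  then have "eval_word \<iota> v = eval_word \<iota> w" using v pres unfolding presents_def by blast
  then show ?thesis using v w by (auto simp: normal_words_def)
qed

lemma normal_words_in: "w \<in> normal_words \<Longrightarrow> w \<in> lists G"
  by (simp add: normal_words_def)

text \<open>A rule that applies inside \<open>v\<close> applies at the same place in
  \<open>v @ w\<close>. Hence letters may be stripped off the end of a normal word.\<close>

lemma normal_words_prefix:
  assumes "v @ w \<in> normal_words"
  shows "v \<in> normal_words"
proof -
  have "\<not> word_step G R v c" for c
  proof
    assume "word_step G R v c"
    then obtain l r w1 w2 where *: "v = w1 @ l @ w2" "(l, r) \<in> R" "w1 \<in> lists G" "w2 \<in> lists G"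
      by cases blast
    then have "word_step G R (w1 @ l @ (w2 @ w)) (w1 @ r @ (w2 @ w))"
      using normal_words_in[OF assms] by (intro word_step.intros) auto
    then show False using assms *(1) by (auto simp: normal_words_def)
  qed
  then show ?thesis using normal_words_in[OF assms] by (auto simp: normal_words_def)
qed

lemma Nil_normal: "[] \<in> normal_words"
proof -
  obtain w where "w \<in> normal_words" using normal_word_exists by blast
  then show ?thesis using normal_words_prefix[of "[]" w] by simp
qed

lemma is_nf_irreducible:
  assumes "is_nf w x"
  shows "\<nexists>c. pstep (w, x) c"
proof
  assume "\<exists>c. pstep (w, x) c"
  then obtain c where "pstep (w, x) c" by blast
  then show False
    using assms by (cases rule: pair_step.cases) (auto simp: is_nf_def normal_words_def)
qed

section \<open>From the globalization relation to reductions of pairs\<close>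

text \<open>The action takes place at the right end of the word, next to the point, so a factor on
  the left does not disturb it.\<close>

lemma pstep_prefix:
  assumes "pstep p q" "u \<in> lists G"
  shows "pstep (u @ fst p, snd p) (u @ fst q, snd q)"
  using assms(1)
proof cases
  case (act w g x y)
  then show ?thesis using pair_step.act[of "u @ w" G g x X \<alpha> \<iota> y R] assms(2) by simp
next
  case (rewrite w1 w2 x)
  from rewrite(3) have "word_step G R (u @ w1) (u @ w2)"
  proof cases
    case (1 l r v1 v2)
    then show ?thesis using word_step.intros[of l r R "u @ v1" G v2] assms(2) by simp
  qed
  then show ?thesis using rewrite by (auto intro: pair_step.rewrite)
qed

lemma psteps_prefix:
  assumes "pstep\<^sup>*\<^sup>* p q" "u \<in> lists G"
  shows "pstep\<^sup>*\<^sup>* (u @ fst p, snd p) (u @ fst q, snd q)"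
  using assms(1) by induction (auto intro: rtranclp.rtrancl_into_rtrancl pstep_prefix[OF _ assms(2)])

lemma pequiv_same_value:
  assumes "v \<in> lists G" "w \<in> lists G" "eval_word \<iota> v = eval_word \<iota> w" "x \<in> X"
  shows "equivclp pstep (v, x) (w, x)"
proof -
  have "equivclp (word_step G R) v w" using assms pres unfolding presents_def by blast
  then show ?thesis
  proof (induction rule: equivclp_induct)
    case (step y z)
    then have "pstep (y, x) (z, x) \<or> pstep (z, x) (y, x)"
      using assms(4) pair_step.rewrite[of G R _ _ x X \<iota> \<alpha>] by blast
    then show ?case using step.IH by (meson equivclp_into_equivclp)
  qed simp
qed

text \<open>Here the last clause of confluence enters: a word acting as a whole can be consumed by
  reductions, and \<open>u\<close> is carried along as a prefix.\<close>

lemma pequiv_act: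
  assumes "u \<in> lists G" "v \<in> lists G" "\<alpha> (eval_word \<iota> v) x = Some y"
  shows "equivclp pstep (u @ v, x) (u, y)"
proof -
  have "pstep\<^sup>*\<^sup>* (v, x) ([], y)" using assms confl_reduces action_in by blast
  then have "pstep\<^sup>*\<^sup>* (u @ v, x) (u, y)" using psteps_prefix[OF _ assms(1)] by fastforce
  then show ?thesis by (rule predicate2D[OF rtranlcp_le_equivclp])
qed

text \<open>With a word \<open>mw\<close> for the factor that acts, \<open>v\<close> and
  \<open>w @ mw\<close> have the same value, and then \<open>mw\<close> is absorbed into the
  point.\<close>

lemma glob_step_imp_pequiv:
  assumes "glob_step \<alpha> p q" "eval_word \<iota> v = fst p" "eval_word \<iota> w = fst q" "v \<in> lists G" "w \<in> lists G"
  shows "equivclp pstep (v, snd p) (w, snd q)"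
  using assms(1)
proof cases
  case (1 m x y u)
  obtain mw where mw: "mw \<in> lists G" "eval_word \<iota> mw = m"
    using normal_word_exists normal_words_in by blast
  have x: "x \<in> X" using 1 action_in by blast
  have "equivclp pstep (v, x) (w @ mw, x)"
    using assms mw 1 x by (intro pequiv_same_value) (auto simp: eval_append)
  also have "equivclp pstep (w @ mw, x) (w, y)"
    using mw 1 assms by (intro pequiv_act) auto
  finally show ?thesis using 1 by simp
qed

lemma glob_equiv_imp_pequiv:
  assumes "equivclp (glob_step \<alpha>) p q" "snd p \<in> X"
    "eval_word \<iota> v = fst p" "eval_word \<iota> w = fst q" "v \<in> lists G" "w \<in> lists G"
  shows "equivclp pstep (v, snd p) (w, snd q)"
  using assms(1,4,6)
proof (induction arbitrary: w rule: equivclp_induct)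
  case base
  \<comment> \<open>The words \<open>v\<close> and \<open>w\<close> may differ even here; they only
    have the same value.\<close>
  then show ?case using assms by (intro pequiv_same_value) auto
next
  case (step y z)
  obtain wy where wy: "wy \<in> lists G" "eval_word \<iota> wy = fst y"
    using normal_word_exists normal_words_in by blast
  have "equivclp pstep (wy, snd y) (w, snd z)"
    using step.hyps(2) glob_step_imp_pequiv[of y z wy w] glob_step_imp_pequiv[of z y w wy] wy step.prems
    by (auto intro: equivclp_sym)
  then show ?case using step.IH[OF wy(2,1)] by (meson equivclp_trans)
qed

lemma equiv_glob_rel: "equiv (UNIV \<times> X) (glob_rel X \<alpha>)"
proof (rule equivI)
  show "refl_on (UNIV \<times> X) (glob_rel X \<alpha>)" by (auto simp: refl_on_def glob_rel_def)
  show "sym (glob_rel X \<alpha>)" by (auto simp: sym_def glob_rel_def intro: equivclp_sym)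
  show "trans (glob_rel X \<alpha>)" by (auto simp: trans_def glob_rel_def intro: equivclp_trans)
  show "glob_rel X \<alpha> \<subseteq> (UNIV \<times> X) \<times> (UNIV \<times> X)" by (auto simp: glob_rel_def)
qed

lemma glob_class_eq_iff:
  assumes "x \<in> X" "y \<in> X"
  shows "glob_class X \<alpha> u x = glob_class X \<alpha> v y \<longleftrightarrow> equivclp (glob_step \<alpha>) (u, x) (v, y)"
  unfolding glob_class_def
  using eq_equiv_class_iff[OF equiv_glob_rel, of "(u, x)" "(v, y)"] assms
  by (auto simp: glob_rel_def)

text \<open>Equal classes come from equivalent pairs, and two irreducible pairs that are equivalent
  coincide by uniqueness of normal forms.\<close>

lemma cls_nf_unique:
  assumes "is_nf w x" "is_nf v y" "cls w x = cls v y"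
  shows "w = v \<and> x = y"
proof -
  have in': "w \<in> lists G" "v \<in> lists G" "x \<in> X" "y \<in> X"
    using assms normal_words_in by (auto simp: is_nf_def)
  have "equivclp (glob_step \<alpha>) (eval_word \<iota> w, x) (eval_word \<iota> v, y)"
    using assms(3) in' by (simp add: cls_def glob_class_eq_iff)
  then have "equivclp pstep (w, x) (v, y)"
    using glob_equiv_imp_pequiv[of _ _ w v] in' by fastforce
  then have "normal_form_in (lists G \<times> X) pstep (w, x) (v, y)"
    using in' is_nf_irreducible[OF assms(2)] by (simp add: normal_form_in_def)
  moreover have "normal_form_in (lists G \<times> X) pstep (w, x) (w, x)"
    using in' is_nf_irreducible[OF assms(1)] by (simp add: normal_form_in_def)
  moreover have "\<exists>!q. normal_form_in (lists G \<times> X) pstep (w, x) q"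
    using in' by (intro nf_unique) simp
  ultimately show ?thesis by blast
qed

text \<open>This is the gluing of the copy of \<open>w @ [g]\<close> to that of \<open>w\<close>
  along the domain of \<open>g\<close>.\<close>

lemma cls_act:
  assumes "\<alpha> (\<iota> g) x = Some y"
  shows "cls (w @ [g]) x = cls w y"
proof -
  have "glob_step \<alpha> (eval_word \<iota> w * \<iota> g, x) (eval_word \<iota> w, y)"
    using assms by (rule glob_step.intros)
  then show ?thesis
    using action_in[OF assms] by (auto simp: cls_def glob_class_eq_iff eval_word_def)
qed

lemma cls_in_glob: "x \<in> X \<Longrightarrow> cls w x \<in> glob X \<alpha>"
  by (auto simp: cls_def glob_def glob_class_def intro: quotientI)

section \<open>Compatible families and lower bounds for the path distance\<close>

text \<open>These are the families of functions on the copies of \<open>X\<close> that glue to a function on the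
  globalization.\<close>

definition compatible :: "('g list \<Rightarrow> 'x \<Rightarrow> real) \<Rightarrow> bool" where
  "compatible F \<longleftrightarrow>
    (\<forall>w g x y. w @ [g] \<in> normal_words \<longrightarrow> \<alpha> (\<iota> g) x = Some y \<longrightarrow> F (w @ [g]) x = F w y)"

text \<open>Letters are stripped off the end while they act. Each time the class is kept by the
  gluing and the value by compatibility; the remaining prefix is still normal, so no rewriting
  intervenes.\<close>

lemma compatible_reduce:
  assumes "compatible F" "w \<in> normal_words" "x \<in> X"
  shows "\<exists>v y. is_nf v y \<and> cls w x = cls v y \<and> F w x = F v y"
  using assms(2,3)
proof (induction w arbitrary: x rule: rev_induct)
  case Nil
  then show ?case by (auto simp: is_nf_def)
next
  case (snoc g w)
  show ?case
  proof (cases "\<alpha> (\<iota> g) x")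
    case None
    then show ?thesis using snoc.prems by (intro exI[of _ "w @ [g]"] exI[of _ x]) (simp add: is_nf_def)
  next
    case (Some y)
    then have "F (w @ [g]) x = F w y" using assms(1) snoc.prems unfolding compatible_def by blast
    moreover have "\<exists>v z. is_nf v z \<and> cls w y = cls v z \<and> F w y = F v z"
      using snoc.prems normal_words_prefix action_in[OF Some] by (intro snoc.IH) blast+
    ultimately show ?thesis using cls_act[OF Some, of w] by simp
  qed
qed

text \<open>Both pairs reduce to the normal form of their common class, with their values unchanged;
  so \<open>F\<close> descends to the globalization.\<close>

lemma compatible_cls:
  assumes "compatible F" "w \<in> normal_words" "x \<in> X" "v \<in> normal_words" "y \<in> X" "cls w x = cls v y"
  shows "F w x = F v y"
  using compatible_reduce[OF assms(1-3)] compatible_reduce[OF assms(1,4,5)] assms(6) cls_nf_unique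
  by metis

lemma glob_nf_exists:
  assumes "a \<in> glob X \<alpha>"
  obtains w x where "is_nf w x" "a = cls w x"
proof -
  obtain m x where x: "x \<in> X" "a = glob_class X \<alpha> m x"
    using assms by (auto simp: glob_def glob_class_def elim: quotientE)
  obtain w where "w \<in> normal_words" "eval_word \<iota> w = m" using normal_word_exists by blast
  then have "a = cls w x" using x by (simp add: cls_def)
  \<comment> \<open>The zero family is used only to extract the normal form from
    \<open>compatible_reduce\<close>.\<close>
  moreover have "compatible (\<lambda>_ _. 0)" by (simp add: compatible_def)
  ultimately show ?thesis using compatible_reduce[of "\<lambda>_ _. 0" w x] \<open>w \<in> _\<close> x that by metis
qed

text \<open>Along a path the function changes by at most \<open>d (p j) (q j)\<close> within the
  \<open>j\<close>-th copy and not at all at a passage between copies.\<close>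

lemma compatible_le_glob_dist:
  assumes F: "compatible F"
    and lip: "\<And>w x y. \<lbrakk>w \<in> normal_words; x \<in> X; y \<in> X\<rbrakk> \<Longrightarrow> \<bar>F w x - F w y\<bar> \<le> d x y"
    and "w \<in> normal_words" "x \<in> X" "v \<in> normal_words" "y \<in> X"
  shows "ennreal \<bar>F w x - F v y\<bar> \<le> glob_dist X d \<alpha> (cls w x) (cls v y)"
proof (rule glob_dist_greatest)
  fix n m p q assume path: "glob_path X \<alpha> n m p q (cls w x) (cls v y)"
  \<comment> \<open>The monoid elements of the path get normal representatives, since
    \<open>F\<close> is controlled on normal words.\<close>
  have "\<forall>j. \<exists>w. w \<in> normal_words \<and> eval_word \<iota> w = m j" using normal_word_exists by blast
  then obtain W where W: "\<And>j. W j \<in> normal_words" "\<And>j. eval_word \<iota> (W j) = m j" by metis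
  have c: "1 \<le> n" "\<And>j. j \<in> {1..n} \<Longrightarrow> p j \<in> X \<and> q j \<in> X" "cls (W 1) (p 1) = cls w x"
    "\<And>j. j \<in> {1..<n} \<Longrightarrow> cls (W j) (q j) = cls (W (j + 1)) (p (j + 1))" "cls (W n) (q n) = cls v y"
    using path by (auto simp: glob_path_def cls_def[of "W _"] W(2))
  have "\<bar>F (W 1) (p 1) - F (W k) (q k)\<bar> \<le> (\<Sum>j=1..k. d (p j) (q j))" if "1 \<le> k" "k \<le> n" for k
    using that
  proof (induction k rule: dec_induct)
    case base
    then show ?case using lip[OF W(1)] c(2) by simp
  next
    case (step k)
    then have "\<bar>F (W 1) (p 1) - F (W k) (q k)\<bar> \<le> (\<Sum>j=1..k. d (p j) (q j))" by simp
    moreover have "F (W k) (q k) = F (W (Suc k)) (p (Suc k))"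
      using c(2)[of k] c(2)[of "Suc k"] c(4)[of k] step W(1) by (intro compatible_cls[OF F]) auto
    moreover have "\<bar>F (W (Suc k)) (p (Suc k)) - F (W (Suc k)) (q (Suc k))\<bar> \<le> d (p (Suc k)) (q (Suc k))"
      using c(2)[of "Suc k"] step by (intro lip[OF W(1)]) auto
    ultimately show ?case by simp
  qed
  from this[OF c(1) order.refl] have "\<bar>F (W 1) (p 1) - F (W n) (q n)\<bar> \<le> (\<Sum>j=1..n. d (p j) (q j))" .
  moreover have "F (W 1) (p 1) = F w x"
    using c(1,3) c(2)[of 1] assms W(1) by (intro compatible_cls[OF F]) auto
  moreover have "F (W n) (q n) = F v y"
    using c(1,5) c(2)[of n] assms W(1) by (intro compatible_cls[OF F]) auto
  ultimately show "ennreal \<bar>F w x - F v y\<bar> \<le> ennreal (\<Sum>j=1..n. d (p j) (q j))"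
    by (intro ennreal_leI) simp
qed

section \<open>Lipschitz functions on the globalization\<close>

abbreviation D where "D \<equiv> glob_dist X d \<alpha>"

abbreviation \<rho> where "\<rho> \<equiv> \<lambda>a b. enn2real (D a b)"

section \<open>McShane extension along words\<close>

definition short_map :: "('x \<Rightarrow> real) \<Rightarrow> bool" where
  "short_map P \<longleftrightarrow> (\<forall>x\<in>X. \<forall>y\<in>X. \<bar>P x - P y\<bar> \<le> d x y)"

text \<open>For 1-Lipschitz \<open>P\<close>, the largest 1-Lipschitz extension to \<open>X\<close>
  of the composite of \<open>g\<close> and \<open>P\<close> on the domain of \<open>g\<close>,
  provided that this domain is nonempty.\<close>

definition mcshane :: "'g \<Rightarrow> ('x \<Rightarrow> real) \<Rightarrow> 'x \<Rightarrow> real" where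
  "mcshane g P x = (INF z\<in>pdom \<alpha> (\<iota> g). P (the (\<alpha> (\<iota> g) z)) + d x z)"

lemma pdom_in: "z \<in> pdom \<alpha> u \<Longrightarrow> z \<in> X"
  using action_in by (auto simp: pdom_def)

lemma mcshane_bdd_below:
  assumes P: "short_map P" and "x \<in> X"
  shows "bdd_below ((\<lambda>z. P (the (\<alpha> (\<iota> g) z)) + d x z) ` pdom \<alpha> (\<iota> g))"
proof (cases "pdom \<alpha> (\<iota> g) = {}")
  case False
  then obtain z0 y0 where z0: "\<alpha> (\<iota> g) z0 = Some y0" by (auto simp: pdom_def)
  show ?thesis
  \<comment> \<open>The bound comes from comparing \<open>z\<close> with the fixed point
    \<open>z0\<close> through \<open>x\<close>, using that \<open>g\<close> is
    non-expansive.\<close>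
  proof (rule bdd_belowI2[of _ "P y0 - d x z0"])
    fix z assume "z \<in> pdom \<alpha> (\<iota> g)"
    then obtain y where z: "\<alpha> (\<iota> g) z = Some y" by (auto simp: pdom_def)
    have "\<bar>P y0 - P y\<bar> \<le> d y0 y" using P action_in[OF z] action_in[OF z0] by (simp add: short_map_def)
    also have "\<dots> \<le> d z0 z" by (rule action_nonexp[OF z0 z])
    also have "\<dots> \<le> d x z0 + d x z"
      using triangle''[of z0 x z] action_in[OF z] action_in[OF z0] assms(2) by simp
    finally show "P y0 - d x z0 \<le> P (the (\<alpha> (\<iota> g) z)) + d x z" using z by simp
  qed
qed simp

text \<open>Every function under the infimum is 1-Lipschitz in \<open>x\<close>, and nowhere
  degeneracy makes the infimum run over a nonempty set.\<close>

lemma mcshane_short: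
  assumes g: "g \<in> G" and P: "short_map P"
  shows "short_map (mcshane g P)"
proof -
  have ne: "pdom \<alpha> (\<iota> g) \<noteq> {}" using nondeg g by (simp add: nowhere_degenerate_def)
  have "mcshane g P x - d x y \<le> mcshane g P y" if x: "x \<in> X" and y: "y \<in> X" for x y
    unfolding mcshane_def[of _ _ y]
  proof (rule cINF_greatest[OF ne])
    fix z assume z: "z \<in> pdom \<alpha> (\<iota> g)"
    have "mcshane g P x \<le> P (the (\<alpha> (\<iota> g) z)) + d x z"
      unfolding mcshane_def by (rule cINF_lower[OF mcshane_bdd_below[OF P x] z])
    also have "d x z \<le> d x y + d y z" using triangle x y pdom_in[OF z] by blast
    finally show "mcshane g P x - d x y \<le> P (the (\<alpha> (\<iota> g) z)) + d y z" by simp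
  qed
  from this this[of y x for x y] show ?thesis
    unfolding short_map_def by (smt (verit) commute)
qed

text \<open>The choice \<open>z = x\<close> gives one inequality; the other holds because the
  composite of \<open>g\<close> and \<open>P\<close> is 1-Lipschitz on the domain of
  \<open>g\<close>.\<close>

lemma mcshane_extends:
  assumes P: "short_map P" and x: "\<alpha> (\<iota> g) x = Some y"
  shows "mcshane g P x = P y"
proof (rule antisym)
  have xd: "x \<in> pdom \<alpha> (\<iota> g)" using x by (simp add: pdom_def)
  have "mcshane g P x \<le> P (the (\<alpha> (\<iota> g) x)) + d x x"
    unfolding mcshane_def by (rule cINF_lower[OF mcshane_bdd_below[OF P] xd]) (use action_in[OF x] in simp)
  then show "mcshane g P x \<le> P y" using x action_in[OF x] by simp
  show "P y \<le> mcshane g P x"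
    unfolding mcshane_def
  proof (rule cINF_greatest)
    fix z assume "z \<in> pdom \<alpha> (\<iota> g)"
    then obtain z' where z: "\<alpha> (\<iota> g) z = Some z'" by (auto simp: pdom_def)
    have "\<bar>P y - P z'\<bar> \<le> d y z'" using P action_in[OF z] action_in[OF x] by (simp add: short_map_def)
    also have "\<dots> \<le> d x z" by (rule action_nonexp[OF x z])
    finally show "P y \<le> P (the (\<alpha> (\<iota> g) z)) + d x z" using z by simp
  qed (use xd in auto)
qed

text \<open>The list is a suffix read backwards: its head is the last letter of the word and is the
  last to be extended along.\<close>

primrec extend :: "('x \<Rightarrow> real) \<Rightarrow> 'g list \<Rightarrow> 'x \<Rightarrow> real" where
  "extend f [] = f"
| "extend f (g # s) = mcshane g (extend f s)"

text \<open>The test says that \<open>w0\<close> is a prefix of \<open>w\<close>, that is, that the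
  copy of \<open>w\<close> lies above that of \<open>w0\<close>.\<close>

definition descend :: "'g list \<Rightarrow> ('x \<Rightarrow> real) \<Rightarrow> 'g list \<Rightarrow> 'x \<Rightarrow> real" where
  "descend w0 f w =
    (if take (length w0) w = w0 then extend f (rev (drop (length w0) w)) else (\<lambda>_. 0))"

lemma extend_short: "\<lbrakk>short_map f; s \<in> lists G\<rbrakk> \<Longrightarrow> short_map (extend f s)"
  by (induction s) (auto intro: mcshane_short)

lemma descend_short:
  assumes "short_map f" "w \<in> lists G"
  shows "short_map (descend w0 f w)"
proof -
  have "rev (drop (length w0) w) \<in> lists G"
    using assms(2) set_drop_subset[of "length w0" w] by (auto simp: subset_iff)
  then show ?thesis
    using extend_short[OF assms(1)] by (auto simp: descend_def short_map_def)
qed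

text \<open>Above \<open>w0\<close> the McShane extension agrees with the gluing. At
  \<open>w0 = w @ [g]\<close> the function \<open>f\<close> vanishes on the gluing set, matching the
  value 0 below. Otherwise both sides are 0.\<close>

lemma descend_compatible:
  assumes f: "short_map f"
    and zero: "\<And>z. \<lbrakk>w0 \<noteq> []; z \<in> pdom \<alpha> (\<iota> (last w0))\<rbrakk> \<Longrightarrow> f z = 0"
  shows "compatible (descend w0 f)"
  unfolding compatible_def
proof (intro allI impI)
  fix w g x y assume wg: "w @ [g] \<in> normal_words" and x: "\<alpha> (\<iota> g) x = Some y"
  let ?n = "length w0"
  show "descend w0 f (w @ [g]) x = descend w0 f w y"
  proof (cases "?n \<le> length w")
    case True
    have "rev (drop ?n w) \<in> lists G"
      using normal_words_in[OF wg] set_drop_subset[of ?n w] by (auto simp: subset_iff)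
    then show ?thesis
      using mcshane_extends[OF extend_short[OF f] x] True by (simp add: descend_def)
  next
    case False
    then have "take ?n w \<noteq> w0" by auto
    moreover have "descend w0 f (w @ [g]) x = 0"
    proof (cases "take ?n (w @ [g]) = w0")
      case True
      then have "w0 = w @ [g]" using False by (simp add: not_le)
      then show ?thesis using zero[of x] x by (simp add: descend_def pdom_def)
    qed (simp add: descend_def)
    ultimately show ?thesis by (simp add: descend_def)
  qed
qed

section \<open>Distance from the gluing sets\<close>

text \<open>The points at distance at least \<open>r\<close> from the gluing set of the copy of
  \<open>w\<close>; the empty word has no gluing set, so its margin is all of
  \<open>X\<close>.\<close>

definition margin :: "'g list \<Rightarrow> real \<Rightarrow> 'x set" where
  "margin w r = {x \<in> X. w \<noteq> [] \<longrightarrow> (\<forall>z\<in>pdom \<alpha> (\<iota> (last w)). r \<le> d x z)}"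

text \<open>The tent of height \<open>r\<close> at \<open>x\<close> vanishes on the gluing set,
  hence glues by \<open>descend\<close>. Copies strictly above that of \<open>w\<close> are excluded
  because the tent is not 0 there in general.\<close>

lemma glob_dist_ge:
  assumes w: "w \<in> normal_words" and x: "x \<in> margin w r" and r: "0 \<le> r"
    and v: "v \<in> normal_words" and y: "y \<in> X" and vw: "v = w \<or> take (length w) v \<noteq> w"
  shows "ennreal (if v = w then min r (d x y) else r) \<le> D (cls w x) (cls v y)"
proof -
  define f where "f y = max 0 (r - d x y)" for y
  have xX: "x \<in> X" using x by (simp add: margin_def)
  have f: "short_map f"
    unfolding short_map_def f_def
  proof (intro ballI)
    fix y z assume "y \<in> X" "z \<in> X"
    then have "\<bar>d x y - d x z\<bar> \<le> d y z"
      using xX mdist_reverse_triangle[of y x z] by (simp add: commute)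
    then show "\<bar>max 0 (r - d x y) - max 0 (r - d x z)\<bar> \<le> d y z" by linarith
  qed
  have "compatible (descend w f)"
    using x by (intro descend_compatible[OF f]) (auto simp: f_def margin_def)
  then have "ennreal \<bar>descend w f w x - descend w f v y\<bar> \<le> D (cls w x) (cls v y)"
    using descend_short[OF f normal_words_in] w v xX y
    by (intro compatible_le_glob_dist) (auto simp: short_map_def)
  moreover have "descend w f w x = r" using xX r by (simp add: descend_def f_def)
  moreover have "descend w f v y = (if v = w then f y else 0)" using vw by (auto simp: descend_def)
  moreover have "\<bar>r - f y\<bar> = min r (d x y)" using r nonneg[of x y] unfolding f_def by linarith
  ultimately show ?thesis using r by (auto split: if_splits)
qed

text \<open>Here closedness of the action enters: a point outside the closed gluing set has a ball
  disjoint from it.\<close>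

lemma is_nf_margin:
  assumes "is_nf w x"
  obtains r where "0 < r" "x \<in> margin w r"
proof (cases "w = []")
  case True
  then show ?thesis using that[of 1] assms by (simp add: margin_def is_nf_def)
next
  case False
  have "closedin mtopology (pdom \<alpha> (\<iota> (last w)))" using closed by (simp add: closed_action_def)
  moreover have "x \<in> X - pdom \<alpha> (\<iota> (last w))" using assms False by (auto simp: is_nf_def pdom_def)
  ultimately obtain r where r: "0 < r" "disjnt (pdom \<alpha> (\<iota> (last w))) (mball x r)"
    unfolding closedin_metric by blast
  have "x \<in> margin w r"
    using r assms pdom_in by (auto simp: margin_def is_nf_def disjnt_iff not_less[symmetric])
  then show ?thesis using that r by blast
qed

text \<open>A point of the gluing set has distance 0 from itself, which is less than
  \<open>r\<close>.\<close>

lemma margin_is_nf: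
  assumes "x \<in> margin w r" "0 < r" "w \<in> normal_words"
  shows "is_nf w x"
proof -
  have "x \<in> X" using assms by (simp add: margin_def)
  then have "w = [] \<or> x \<notin> pdom \<alpha> (\<iota> (last w))"
    using assms by (force simp: margin_def)
  then show ?thesis using assms \<open>x \<in> X\<close> by (auto simp: is_nf_def pdom_def)
qed

section \<open>Finiteness and the metric axioms\<close>

text \<open>In the copy of \<open>w @ [g]\<close> one walks from \<open>x\<close> to a point of the
  domain of \<open>g\<close>, which exists by nowhere degeneracy, and there passes to the copy of
  \<open>w\<close>.\<close>

lemma glob_dist_cls_Nil_finite:
  assumes "w \<in> lists G" "x \<in> X"
  shows "\<exists>y\<in>X. D (cls w x) (cls [] y) < \<infinity>"
  using assms
proof (induction w arbitrary: x rule: rev_induct)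
  case Nil
  have "D (cls [] x) (cls [] x) \<le> ennreal (d x x)"
    unfolding cls_def by (rule glob_dist_same_sheet) (use Nil in auto)
  then show ?case using Nil ennreal_less_top le_less_trans by (intro bexI[of _ x]) auto
next
  case (snoc g w)
  then obtain z z' where z: "\<alpha> (\<iota> g) z = Some z'"
    using nondeg by (fastforce simp: nowhere_degenerate_def pdom_def)
  then obtain y where y: "y \<in> X" "D (cls w z') (cls [] y) < \<infinity>"
    using snoc.IH[of z'] snoc.prems action_in[OF z] by auto
  have "D (cls (w @ [g]) x) (cls (w @ [g]) z) \<le> ennreal (d x z)"
    unfolding cls_def by (rule glob_dist_same_sheet) (use snoc.prems action_in[OF z] in auto)
  then have "D (cls (w @ [g]) x) (cls w z') < \<infinity>"
    unfolding cls_act[OF z] using le_less_trans[OF _ ennreal_less_top] by simp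
  then have "D (cls (w @ [g]) x) (cls w z') + D (cls w z') (cls [] y) < \<infinity>" using y by simp
  then have "D (cls (w @ [g]) x) (cls [] y) < \<infinity>"
    by (rule le_less_trans[OF glob_dist_triangle[of d, OF nonneg]])
  then show ?case using y(1) by blast
qed

lemma glob_dist_finite:
  assumes "a \<in> glob X \<alpha>" "b \<in> glob X \<alpha>"
  shows "D a b < \<infinity>"
proof -
  obtain w x v y where a: "is_nf w x" "a = cls w x" and b: "is_nf v y" "b = cls v y"
    using glob_nf_exists assms by metis
  obtain x' where x': "x' \<in> X" "D a (cls [] x') < \<infinity>"
    using glob_dist_cls_Nil_finite[of w x] a normal_words_in by (auto simp: is_nf_def)
  obtain y' where y': "y' \<in> X" "D b (cls [] y') < \<infinity>"
    using glob_dist_cls_Nil_finite[of v y] b normal_words_in by (auto simp: is_nf_def)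
  have "D (cls [] x') (cls [] y') \<le> ennreal (d x' y')"
    unfolding cls_def by (rule glob_dist_same_sheet) (use x' y' in auto)
  then have 1: "D (cls [] x') (cls [] y') < \<infinity>" using le_less_trans[OF _ ennreal_less_top] by simp
  have 2: "D (cls [] y') b < \<infinity>" using y' glob_dist_commute[of d, OF commute] by metis
  have "D a b \<le> D a (cls [] x') + D (cls [] x') b" by (rule glob_dist_triangle[OF nonneg])
  also have "\<dots> \<le> D a (cls [] x') + (D (cls [] x') (cls [] y') + D (cls [] y') b)"
    by (intro add_left_mono glob_dist_triangle[OF nonneg])
  also have "\<dots> < \<infinity>" using x' 1 2 by simp
  finally show ?thesis .
qed

text \<open>Finiteness is what makes this true, since \<open>enn2real\<close> sends \<infinity> to
  0.\<close>

lemma ennreal_rho: "\<lbrakk>a \<in> glob X \<alpha>; b \<in> glob X \<alpha>\<rbrakk> \<Longrightarrow> ennreal (\<rho> a b) = D a b"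
  using glob_dist_finite by (simp add: less_top)

lemma rho_ge:
  assumes "w \<in> normal_words" "x \<in> margin w r" "0 \<le> r"
    and "v \<in> normal_words" "y \<in> X" "v = w \<or> take (length w) v \<noteq> w"
  shows "(if v = w then min r (d x y) else r) \<le> \<rho> (cls w x) (cls v y)"
proof -
  have "x \<in> X" using assms by (simp add: margin_def)
  then have "ennreal (if v = w then min r (d x y) else r) \<le> ennreal (\<rho> (cls w x) (cls v y))"
    using glob_dist_ge[OF assms] assms(5) by (simp add: ennreal_rho cls_in_glob)
  then show ?thesis by (subst (asm) ennreal_le_iff) auto
qed

lemma rho_le: "\<lbrakk>x \<in> X; y \<in> X\<rbrakk> \<Longrightarrow> \<rho> (cls w x) (cls w y) \<le> d x y"
  using glob_dist_same_sheet[of x X y d \<alpha> "eval_word \<iota> w"]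
  by (intro enn2real_leI) (simp_all add: cls_def)

lemma rho_commute: "\<rho> a b = \<rho> b a"
  using glob_dist_commute[of d, OF commute] by metis

text \<open>The normal form with the longer word is taken as the centre, so that the other copy is
  not strictly above it. Its positive margin then forces equal words and distance 0 in
  \<open>X\<close>.\<close>

lemma rho_eq_0_imp:
  assumes "a \<in> glob X \<alpha>" "b \<in> glob X \<alpha>" "\<rho> a b = 0"
  shows "a = b"
proof -
  have *: "cls w x = cls v y"
    if nf: "is_nf w x" "is_nf v y" and len: "length v \<le> length w" and 0: "\<rho> (cls w x) (cls v y) = 0"
    for w x v y
  proof -
    obtain r where r: "0 < r" "x \<in> margin w r" using is_nf_margin[OF nf(1)] by blast
    have "v = w \<or> take (length w) v \<noteq> w" using len by auto
    then have "(if v = w then min r (d x y) else r) \<le> 0"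
      using rho_ge[of w x r v y] r nf 0 by (auto simp: is_nf_def)
    then have "v = w" "d x y \<le> 0" using r by (auto split: if_splits)
    then show ?thesis using nf nonneg[of x y] by (auto simp: is_nf_def)
  qed
  obtain w x where a: "is_nf w x" "a = cls w x" using glob_nf_exists assms(1) by blast
  obtain v y where b: "is_nf v y" "b = cls v y" using glob_nf_exists assms(2) by blast
  show ?thesis
    using *[OF a(1) b(1)] *[OF b(1) a(1)] a(2) b(2) assms(3) rho_commute[of a b] by (metis nat_le_linear)
qed

lemma Metric_space_glob: "Metric_space (glob X \<alpha>) \<rho>"
proof
  show "\<rho> a b = 0 \<longleftrightarrow> a = b" if ab: "a \<in> glob X \<alpha>" "b \<in> glob X \<alpha>" for a b
  proof
    assume "a = b"
    obtain w x where a: "is_nf w x" "a = cls w x" using glob_nf_exists[OF ab(1)] by blast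
    then have "\<rho> a a \<le> 0" using rho_le[of x x w] by (simp add: is_nf_def)
    then show "\<rho> a b = 0" using \<open>a = b\<close> by (simp add: antisym)
  qed (rule rho_eq_0_imp[OF ab])
  show "\<rho> a c \<le> \<rho> a b + \<rho> b c" if "a \<in> glob X \<alpha>" "b \<in> glob X \<alpha>" "c \<in> glob X \<alpha>" for a b c
  proof (rule enn2real_leI)
    show "D a c \<le> ennreal (\<rho> a b + \<rho> b c)"
      using glob_dist_triangle[of d X \<alpha> a c b, OF nonneg] that by (simp add: ennreal_rho)
  qed simp
qed (rule rho_commute | simp)+

section \<open>The dimension of the globalization\<close>

sublocale glob: Metric_space "glob X \<alpha>" \<rho>
  by (rule Metric_space_glob)

text \<open>Distinct words of equal length are not prefixes of each other, so the pieces of a slab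
  over distinct words are at distance at least \<open>r\<close>.\<close>

definition slab :: "nat \<Rightarrow> real \<Rightarrow> ('m \<times> 'x) set set" where
  "slab k r = {cls w x | w x. w \<in> normal_words \<and> length w = k \<and> x \<in> margin w r}"

lemma margin_in: "x \<in> margin w r \<Longrightarrow> x \<in> X"
  by (simp add: margin_def)

lemma slab_subset: "slab k r \<subseteq> glob X \<alpha>"
  by (auto simp: slab_def intro: cls_in_glob margin_in)

lemma closedin_margin: "closedin mtopology (margin w r)"
  unfolding closedin_metric
proof (intro conjI allI impI)
  fix x assume x: "x \<in> X - margin w r"
  then obtain z where w: "w \<noteq> []" and z: "z \<in> pdom \<alpha> (\<iota> (last w))" "d x z < r"
    by (auto simp: margin_def not_le)
  \<comment> \<open>All points this close to \<open>x\<close> are, like \<open>x\<close>, at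
    distance less than \<open>r\<close> from \<open>z\<close>.\<close>
  have "x' \<notin> mball x (r - d x z)" if x': "x' \<in> margin w r" for x'
  proof
    assume "x' \<in> mball x (r - d x z)"
    moreover have "r \<le> d x' z" using x' w z by (simp add: margin_def)
    moreover have "d x' z \<le> d x x' + d x z"
      using triangle''[of x' x z] x margin_in[OF x'] pdom_in[OF z(1)] by simp
    ultimately show False by simp
  qed
  then show "\<exists>e>0. disjnt (margin w r) (mball x e)"
    using z(2) by (intro exI[of _ "r - d x z"]) (auto simp: disjnt_iff)
qed (auto intro: margin_in)

lemma rho_ge_same_length:
  assumes "w \<in> normal_words" "x \<in> margin w r" "0 \<le> r" "v \<in> normal_words" "y \<in> X" "length v = length w"
  shows "(if v = w then min r (d x y) else r) \<le> \<rho> (cls w x) (cls v y)"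
  using assms by (intro rho_ge) auto

text \<open>The lower bound is centred at whichever point has the longer word: at \<open>b\<close>
  with its own margin \<open>s\<close>, or at the slab points with margin \<open>r\<close>. For
  equal lengths the slab points are the centres as well.\<close>

lemma closedin_slab:
  assumes r: "0 < r"
  shows "closedin glob.mtopology (slab k r)"
  unfolding glob.closedin_metric
proof (intro conjI allI impI slab_subset)
  fix b assume b: "b \<in> glob X \<alpha> - slab k r"
  then obtain v y where nf: "is_nf v y" and bv: "b = cls v y" using glob_nf_exists by blast
  then have v: "v \<in> normal_words" and y: "y \<in> X" by (auto simp: is_nf_def)
  have "\<exists>e>0. \<forall>w x. w \<in> normal_words \<longrightarrow> length w = k \<longrightarrow> x \<in> margin w r \<longrightarrow> e \<le> \<rho> b (cls w x)"
  proof -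
    consider "k < length v" | "length v < k" | "length v = k" by linarith
    then show ?thesis
    proof cases
      case 1
      obtain s where s: "0 < s" "y \<in> margin v s" using is_nf_margin[OF nf] by blast
      have "s \<le> \<rho> b (cls w x)" if "w \<in> normal_words" "length w = k" "x \<in> margin w r" for w x
      proof -
        have "w \<noteq> v" "take (length v) w \<noteq> v" using 1 that(2) by auto
        then show ?thesis using rho_ge[of v y s w x] s v that margin_in bv by auto
      qed
      then show ?thesis using s(1) by blast
    next
      case 2
      have "r \<le> \<rho> b (cls w x)" if "w \<in> normal_words" "length w = k" "x \<in> margin w r" for w x
      proof -
        have "w \<noteq> v" "take (length w) v \<noteq> w" using 2 that(2) by auto
        then have "r \<le> \<rho> (cls w x) b" using rho_ge[of w x r v y] r v y that bv by auto
        then show ?thesis using rho_commute[of b] by simp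
      qed
      then show ?thesis using r by blast
    next
      case 3
      have "y \<notin> margin v r" using b bv v 3 by (auto simp: slab_def)
      then obtain z where z: "v \<noteq> []" "z \<in> pdom \<alpha> (\<iota> (last v))" "d y z < r"
        using y by (auto simp: margin_def not_le)
      \<comment> \<open>The point \<open>z\<close> witnesses that \<open>y\<close> is too close to
        the gluing set. Over the same word the constant comes from the triangle inequality through
        \<open>z\<close>; over other words the distance is even at least \<open>r\<close>.\<close>
      have "r - d y z \<le> \<rho> b (cls w x)" if w: "w \<in> normal_words" "length w = k" "x \<in> margin w r" for w x
      proof -
        have le: "(if v = w then min r (d x y) else r) \<le> \<rho> b (cls w x)"
          using rho_ge_same_length[of w x r v y] r v y w bv 3 rho_commute[of b] by auto
        moreover have "r - d y z \<le> d x y" if "v = w"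
        proof -
          have "r \<le> d x z" using w(3) z that by (simp add: margin_def)
          also have "\<dots> \<le> d x y + d y z" using triangle margin_in[OF w(3)] y pdom_in[OF z(2)] by blast
          finally show ?thesis by simp
        qed
        ultimately have "r - d y z \<le> (if v = w then min r (d x y) else r)" by simp
        then show ?thesis using le by (rule order_trans)
      qed
      then show ?thesis using z(3) by (intro exI[of _ "r - d y z"]) auto
    qed
  qed
  then obtain e where e: "0 < e"
    "\<And>w x. \<lbrakk>w \<in> normal_words; length w = k; x \<in> margin w r\<rbrakk> \<Longrightarrow> e \<le> \<rho> b (cls w x)" by blast
  have "disjnt (slab k r) (glob.mball b e)"
    unfolding disjnt_iff
  proof (intro allI notI, elim conjE)
    fix a assume "a \<in> slab k r" "a \<in> glob.mball b e"
    then show False using e(2) by (fastforce simp: slab_def)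
  qed
  then show "\<exists>e>0. disjnt (slab k r) (glob.mball b e)" using e(1) by blast
qed

text \<open>The slab is a uniformly discrete union of closed pieces of \<open>X\<close>, so
  shrinkings chosen on each piece can be united. All are indexed by the same finite cover, which
  keeps the union finite even for infinitely many words.\<close>

lemma slab_dim_le:
  assumes dim: "covering_dim_le mtopology (int N - 1)" and r: "0 < r"
  shows "covering_dim_le (subtopology glob.mtopology (slab k r)) (int N - 1)"
proof (rule covering_dim_leI)
  fix \<U> assume fin: "finite \<U>" and cov: "open_cover (subtopology glob.mtopology (slab k r)) \<U>"
  interpret S: Submetric "glob X \<alpha>" \<rho> "slab k r"
    by unfold_locales (rule slab_subset)
  have S: "subtopology glob.mtopology (slab k r) = S.sub.mtopology" by (rule S.mtopology_submetric[symmetric])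
  have Uop: "openin S.sub.mtopology U" if "U \<in> \<U>" for U using cov that by (simp add: open_cover_def S)
  have Ucov: "\<Union>\<U> = slab k r" using cov by (simp add: open_cover_def S)
  define NW where "NW = {w \<in> normal_words. length w = k}"
  have in_slab: "cls w x \<in> slab k r" if "w \<in> NW" "x \<in> margin w r" for w x
    using that by (auto simp: slab_def NW_def)
  \<comment> \<open>\<open>V\<close> is an open shrinking on the piece over \<open>w\<close>.
    Openness is written out with radii because the subspace metric of that piece is interpreted only
    inside the block for a fixed \<open>w\<close>.\<close>
  define P where "P w V \<longleftrightarrow>
    (\<forall>U\<in>\<U>. (\<forall>x\<in>V U. \<exists>e>0. \<forall>x'\<in>margin w r. d x x' < e \<longrightarrow> x' \<in> V U) \<and>
      V U \<subseteq> {x \<in> margin w r. cls w x \<in> U}) \<and>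
    margin w r \<subseteq> (\<Union>U\<in>\<U>. V U) \<and> (\<forall>x\<in>margin w r. card {U \<in> \<U>. x \<in> V U} \<le> N)" for w V
  have "\<exists>V. P w V" if w: "w \<in> NW" for w
  proof -
    interpret M: Submetric X d "margin w r"
      by unfold_locales (auto intro: margin_in)
    have "covering_dim_le (subtopology mtopology (margin w r)) (int N - 1)"
      by (rule covering_dim_le_closed_subtopology[OF closedin_margin dim])
    then have dimM: "covering_dim_le M.sub.mtopology (int N - 1)" by (simp add: M.mtopology_submetric)
    have op: "openin M.sub.mtopology {x \<in> margin w r. cls w x \<in> U}" if U: "U \<in> \<U>" for U
      unfolding M.sub.openin_mtopology
    proof (intro conjI allI impI)
      fix x assume x: "x \<in> {x \<in> margin w r. cls w x \<in> U}"
      then obtain e where e: "e > 0" "S.sub.mball (cls w x) e \<subseteq> U"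
        using Uop[OF U] unfolding S.sub.openin_mtopology by blast
      have "cls w x' \<in> U" if "x' \<in> margin w r" "d x x' < e" for x'
      proof -
        have "\<rho> (cls w x) (cls w x') < e" using rho_le[of x x' w] that x margin_in by fastforce
        then show ?thesis using e(2) in_slab[OF w] that(1) x by (auto simp: subset_iff)
      qed
      then show "\<exists>e>0. M.sub.mball x e \<subseteq> {x \<in> margin w r. cls w x \<in> U}"
        using e(1) by (intro exI[of _ e]) auto
    qed auto
    have cov: "topspace M.sub.mtopology \<subseteq> (\<Union>U\<in>\<U>. {x \<in> margin w r. cls w x \<in> U})"
      using Ucov in_slab[OF w] by auto
    obtain V where V: "\<And>U. U \<in> \<U> \<Longrightarrow> openin M.sub.mtopology (V U)"
      "\<And>U. U \<in> \<U> \<Longrightarrow> V U \<subseteq> {x \<in> margin w r. cls w x \<in> U}"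
      "topspace M.sub.mtopology \<subseteq> (\<Union>U\<in>\<U>. V U)"
      "\<And>x. x \<in> topspace M.sub.mtopology \<Longrightarrow> card {U \<in> \<U>. x \<in> V U} \<le> N"
      by (rule covering_dim_le_shrink[OF dimM fin op cov]) blast+
    show ?thesis
      unfolding P_def
    proof (intro exI[of _ V] conjI ballI)
      fix U x assume "U \<in> \<U>" "x \<in> V U"
      then obtain e where "e > 0" "M.sub.mball x e \<subseteq> V U" "x \<in> margin w r"
        using V(1,2) unfolding M.sub.openin_mtopology by blast
      then show "\<exists>e>0. \<forall>x'\<in>margin w r. d x x' < e \<longrightarrow> x' \<in> V U"
        by (intro exI[of _ e]) (auto simp: subset_iff)
    qed (use V(2-4) in auto)
  qed
  then obtain V where V: "\<And>w. w \<in> NW \<Longrightarrow> P w (V w)" by metis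
  have V1: "\<exists>e>0. \<forall>x'\<in>margin w r. d x x' < e \<longrightarrow> x' \<in> V w U" if "w \<in> NW" "U \<in> \<U>" "x \<in> V w U" for w U x
    using V[OF that(1)] that(2,3) unfolding P_def by blast
  have V2: "V w U \<subseteq> {x \<in> margin w r. cls w x \<in> U}" if "w \<in> NW" "U \<in> \<U>" for w U
    using V[OF that(1)] that(2) unfolding P_def by blast
  have V3: "margin w r \<subseteq> (\<Union>U\<in>\<U>. V w U)" if "w \<in> NW" for w
    using V[OF that] unfolding P_def by blast
  have V4: "card {U \<in> \<U>. x \<in> V w U} \<le> N" if "w \<in> NW" "x \<in> margin w r" for w x
    using V[OF that(1)] that(2) unfolding P_def by blast
  define V' where "V' U = {cls w x | w x. w \<in> NW \<and> x \<in> V w U}" for U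
  have "openin S.sub.mtopology (V' U)" if U: "U \<in> \<U>" for U
    unfolding S.sub.openin_mtopology
  proof (intro conjI allI impI)
    show "V' U \<subseteq> slab k r" using V2[OF _ U] in_slab by (auto simp: V'_def)
    fix a assume "a \<in> V' U"
    then obtain w x where a: "a = cls w x" "w \<in> NW" "x \<in> V w U" by (auto simp: V'_def)
    obtain e where e: "e > 0" "\<And>x'. \<lbrakk>x' \<in> margin w r; d x x' < e\<rbrakk> \<Longrightarrow> x' \<in> V w U"
      using V1[OF a(2) U a(3)] by blast
    have x: "x \<in> margin w r" using V2[OF a(2) U] a(3) by blast
    \<comment> \<open>Closer than \<open>r\<close>, the point stays over the same word and keeps its
      distance in \<open>X\<close>; closer than \<open>e\<close>, it stays in
      \<open>V w U\<close>.\<close>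
    have "b \<in> V' U" if b: "b \<in> S.sub.mball a (min r e)" for b
    proof -
      have "b \<in> slab k r" using b by simp
      then obtain v y where v: "b = cls v y" "v \<in> NW" "y \<in> margin v r"
        by (auto simp: slab_def NW_def)
      have "(if v = w then min r (d x y) else r) \<le> \<rho> a b"
        using rho_ge_same_length[of w x r v y] a v x r margin_in by (auto simp: NW_def)
      moreover have "\<rho> a b < min r e" using b by simp
      ultimately have "v = w" "d x y < e" by (auto split: if_splits)
      then show ?thesis using e(2) v by (auto simp: V'_def)
    qed
    then show "\<exists>e>0. S.sub.mball a e \<subseteq> V' U" using r e(1) by (intro exI[of _ "min r e"]) auto
  qed
  moreover have "V' U \<subseteq> U" if "U \<in> \<U>" for U using V2[OF _ that] by (auto simp: V'_def)
  moreover have "slab k r \<subseteq> (\<Union>U\<in>\<U>. V' U)"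
  proof
    fix a assume "a \<in> slab k r"
    then obtain w x where a: "a = cls w x" "w \<in> NW" "x \<in> margin w r" by (auto simp: slab_def NW_def)
    then obtain U where "U \<in> \<U>" "x \<in> V w U" using V3 by blast
    then show "a \<in> (\<Union>U\<in>\<U>. V' U)" using a by (auto simp: V'_def)
  qed
  moreover have "card {U \<in> \<U>. a \<in> V' U} \<le> N" if "a \<in> slab k r" for a
  proof -
    obtain w x where a: "a = cls w x" "w \<in> NW" "x \<in> margin w r" using \<open>a \<in> slab k r\<close> by (auto simp: slab_def NW_def)
    \<comment> \<open>Uniqueness of normal forms puts \<open>a\<close> on one piece only, so the
      order is that of the shrinking there.\<close>
    have "x \<in> V w U" if U: "U \<in> \<U>" and "a \<in> V' U" for U
    proof -
      obtain v y where v: "a = cls v y" "v \<in> NW" "y \<in> V v U" using \<open>a \<in> V' U\<close> by (auto simp: V'_def)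
      then have "is_nf v y" "is_nf w x"
        using V2[OF v(2) U] a margin_is_nf r by (auto simp: NW_def)
      then show ?thesis using cls_nf_unique[of v y w x] a v by auto
    qed
    then have "card {U \<in> \<U>. a \<in> V' U} \<le> card {U \<in> \<U>. x \<in> V w U}"
      using fin by (intro card_mono) auto
    then show ?thesis using V4[OF a(2,3)] by simp
  qed
  ultimately show "\<exists>V. (\<forall>U\<in>\<U>. openin (subtopology glob.mtopology (slab k r)) (V U) \<and> V U \<subseteq> U) \<and>
      topspace (subtopology glob.mtopology (slab k r)) \<subseteq> (\<Union>U\<in>\<U>. V U) \<and>
      (\<forall>x\<in>topspace (subtopology glob.mtopology (slab k r)). card {U\<in>\<U>. x \<in> V U} \<le> N)"
    unfolding S by (intro exI[of _ V']) simp
qed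

lemma glob_dim_le:
  assumes dim: "covering_dim_le mtopology (int N - 1)"
  shows "covering_dim_le glob.mtopology (int N - 1)"
proof (rule covering_dim_le_countable_closed_sum)
  \<comment> \<open>Lengths and radii \<open>1 / (n + 1)\<close> give countably many slabs, however
    many words there are; each normal form has a positive margin and so lies in one of them.\<close>
  let ?F = "\<lambda>j. case prod_decode j of (k, n) \<Rightarrow> slab k (inverse (real (Suc n)))"
  show "normal_space glob.mtopology" by (rule glob.normal_space_mtopology)
  show "closedin glob.mtopology (?F j)" for j
    by (simp add: closedin_slab split: prod.split)
  show "covering_dim_le (subtopology glob.mtopology (?F j)) (int N - 1)" for j
    using slab_dim_le[OF dim] by (simp split: prod.split)
  show "topspace glob.mtopology \<subseteq> (\<Union>j. ?F j)"
  proof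
    fix a assume "a \<in> topspace glob.mtopology"
    then obtain w x where a: "is_nf w x" "a = cls w x" using glob_nf_exists by auto
    then obtain r where r: "0 < r" "x \<in> margin w r" using is_nf_margin by blast
    obtain n where n: "inverse (real (Suc n)) < r" using reals_Archimedean[OF r(1)] by blast
    then have "x \<in> margin w (inverse (real (Suc n)))" using r(2) by (fastforce simp: margin_def)
    then have "a \<in> ?F (prod_encode (length w, n))" using a by (auto simp: slab_def is_nf_def)
    then show "a \<in> (\<Union>j. ?F j)" by (rule UN_I[OF UNIV_I])
  qed
qed

text \<open>The copy of the empty word is a closed embedded \<open>X\<close>: its pairs are all
  normal forms, \<open>rho_le\<close> gives continuity, and \<open>rho_ge\<close> keeps points off a
  closed image at positive distance.\<close>

lemma dim_le_of_glob_dim_le: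
  assumes dim: "covering_dim_le glob.mtopology (int N - 1)"
  shows "covering_dim_le mtopology (int N - 1)"
proof (rule covering_dim_le_closed_map[OF _ _ _ dim])
  have nf: "is_nf [] x" if "x \<in> X" for x using that Nil_normal by (simp add: is_nf_def)
  show "inj_on (cls []) (topspace mtopology)"
    using cls_nf_unique[OF nf nf] by (intro inj_onI) simp
  show "continuous_map mtopology glob.mtopology (cls [])"
    unfolding continuous_map_def
  proof (intro conjI allI impI)
    fix U assume U: "openin glob.mtopology U"
    show "openin mtopology {x \<in> topspace mtopology. cls [] x \<in> U}"
      unfolding openin_mtopology
    proof (intro conjI allI impI)
      fix x assume x: "x \<in> {x \<in> topspace mtopology. cls [] x \<in> U}"
      then obtain e where e: "e > 0" "glob.mball (cls [] x) e \<subseteq> U"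
        using U unfolding glob.openin_mtopology by blast
      have "cls [] x' \<in> U" if "x' \<in> mball x e" for x'
      proof -
        have "\<rho> (cls [] x) (cls [] x') < e" using rho_le[of x x' "[]"] that by simp
        then show ?thesis using e(2) that cls_in_glob by (auto simp: subset_iff)
      qed
      then show "\<exists>e>0. mball x e \<subseteq> {x \<in> topspace mtopology. cls [] x \<in> U}"
        using e(1) by (intro exI[of _ e]) auto
    qed auto
  qed (auto intro: cls_in_glob)
  show "closed_map mtopology glob.mtopology (cls [])"
    unfolding closed_map_def
  proof (intro allI impI)
    fix C assume C: "closedin mtopology C"
    then have CX: "C \<subseteq> X" using closedin_subset by fastforce
    show "closedin glob.mtopology (cls [] ` C)"
      unfolding glob.closedin_metric
    proof (intro conjI allI impI)
      show "cls [] ` C \<subseteq> glob X \<alpha>" using CX cls_in_glob by blast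
      fix b assume b: "b \<in> glob X \<alpha> - cls [] ` C"
      then obtain v y where v: "is_nf v y" "b = cls v y" using glob_nf_exists by blast
      have "\<exists>e>0. \<forall>x\<in>C. e \<le> \<rho> b (cls [] x)"
      \<comment> \<open>Over the empty word every radius is a margin, so closedness of
        \<open>C\<close> supplies \<open>e\<close>. Otherwise the empty word is not above
        \<open>v\<close>, and the margin of \<open>y\<close> bounds the distance.\<close>
      proof (cases "v = []")
        case True
        then have y: "y \<in> X - C" using v b by (auto simp: is_nf_def)
        then obtain e where e: "e > 0" "disjnt C (mball y e)" using C closedin_metric by blast
        have "e \<le> \<rho> b (cls [] x)" if "x \<in> C" for x
        proof -
          have "e \<le> d y x" using e(2) that y CX by (auto simp: disjnt_iff not_less)
          moreover have "min e (d y x) \<le> \<rho> (cls [] y) (cls [] x)"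
            using rho_ge[of "[]" y e "[]" x] Nil_normal y that CX e(1) by (auto simp: margin_def)
          ultimately show ?thesis using True v(2) by simp
        qed
        then show ?thesis using e(1) by blast
      next
        case False
        obtain s where s: "0 < s" "y \<in> margin v s" using is_nf_margin[OF v(1)] by blast
        have "s \<le> \<rho> b (cls [] x)" if "x \<in> C" for x
          using rho_ge[of v y s "[]" x] s v False that CX Nil_normal by (auto simp: is_nf_def)
        then show ?thesis using s(1) by blast
      qed
      then obtain e where "e > 0" "\<forall>x\<in>C. e \<le> \<rho> b (cls [] x)" by blast
      then show "\<exists>e>0. disjnt (cls [] ` C) (glob.mball b e)"
        by (intro exI[of _ e]) (force simp: disjnt_iff)
    qed
  qed
qed

lemma covering_dim_glob: "covering_dim glob.mtopology = covering_dim mtopology"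
proof -
  have "covering_dim_le glob.mtopology n \<longleftrightarrow> covering_dim_le mtopology n" if "-1 \<le> n" for n
  proof -
    \<comment> \<open>Bounds \<open>n \<ge> -1\<close> are exactly those of the form
      \<open>int N - 1\<close>.\<close>
    have "n = int (nat (n + 1)) - 1" using that by simp
    then show ?thesis using glob_dim_le dim_le_of_glob_dim_le by metis
  qed
  then have "{n. -1 \<le> n \<and> covering_dim_le glob.mtopology n} = {n. -1 \<le> n \<and> covering_dim_le mtopology n}"
    by blast
  then show ?thesis by (simp add: covering_dim_def)
qed

end

theorem theorem5p14:
  fixes X :: "'x set"
    and d :: "'x \<Rightarrow> 'x \<Rightarrow> real"
    and \<alpha> :: "'m::monoid_mult \<Rightarrow> 'x \<Rightarrow> 'x option"
    and G :: "'g set"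
    and R :: "('g list \<times> 'g list) set"
    and \<iota> :: "'g \<Rightarrow> 'm"
  defines "Y \<equiv> glob X \<alpha>"
    and "D \<equiv> glob_dist X d \<alpha>"
  assumes "Metric_space X d"
    and "partial_action X \<alpha>"
    and "non_expansive d \<alpha>"
    and "confluent_action G R \<iota> X \<alpha>"
    and "closed_action X d \<alpha>"
    and "nowhere_degenerate G \<iota> \<alpha>"
  shows "(\<forall>a\<in>Y. \<forall>b\<in>Y. D a b < \<infinity>) \<and>
         Metric_space Y (\<lambda>a b. enn2real (D a b)) \<and>
         covering_dim (Metric_space.mtopology Y (\<lambda>a b. enn2real (D a b))) =
           covering_dim (Metric_space.mtopology X d)"
proof -
  interpret confluent_globalization X d \<alpha> G R \<iota>
    using assms by (simp add: confluent_globalization_def confluent_globalization_axioms_def)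
  show ?thesis
    unfolding Y_def D_def using glob_dist_finite Metric_space_glob covering_dim_glob by blast
qed

end
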